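(* Let $R$ be a ring. Then $R$ is strongly 2-nil-clean if and only if the following three conditions all hold: (1) $R$ is weakly exchange; (2) the Jacobson radical $J(R)$ is nil; (3) the unit group $U(R/J(R))$ has exponent $\leq 2$.
   Context: All rings are associative with identity (not necessarily commutative). $J(R)$ denotes the Jacobson radical and $U(R)$ the group of units of $R$. A ring $R$ is strongly 2-nil-clean if every element $a\in R$ can be written as $a=e+f+w$ with $e,f\in R$ idempotents and $w\in R$ nilpotent, where $e,f,w$ commute with one another. A ring $R$ is weakly exchange if for every $a\in R$ there exists an idempotent $e\in R$ such that $e\in aR$ and $1-e\in (1-a)R\cup(1+a)R$. "$U(R/J(R))$ has exponent $\leq 2$" means $v^2=1$ for all $v\in U(R/J(R))$. *)

theory Defs
  imports "HOL-Algebra.Algebra"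
begin

text \<open>
  Rings are those of the locale \<^locale>\<open>ring\<close>: associative, unital, not necessarily
  commutative, and possibly zero.
\<close>

definition idempotent_in :: "('a, 'm) ring_scheme \<Rightarrow> 'a \<Rightarrow> bool" where
  "idempotent_in R e \<longleftrightarrow> e \<in> carrier R \<and> e \<otimes>\<^bsub>R\<^esub> e = e"

definition nilpotent_in :: "('a, 'm) ring_scheme \<Rightarrow> 'a \<Rightarrow> bool" where
  "nilpotent_in R w \<longleftrightarrow> w \<in> carrier R \<and> (\<exists>n::nat. w [^]\<^bsub>R\<^esub> n = \<zero>\<^bsub>R\<^esub>)"

definition strongly_2_nil_clean :: "('a, 'm) ring_scheme \<Rightarrow> bool" where
  "strongly_2_nil_clean R \<longleftrightarrow>
     (\<forall>a\<in>carrier R. \<exists>e f w.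
        idempotent_in R e \<and> idempotent_in R f \<and> nilpotent_in R w \<and>
        a = e \<oplus>\<^bsub>R\<^esub> f \<oplus>\<^bsub>R\<^esub> w \<and>
        e \<otimes>\<^bsub>R\<^esub> f = f \<otimes>\<^bsub>R\<^esub> e \<and>
        e \<otimes>\<^bsub>R\<^esub> w = w \<otimes>\<^bsub>R\<^esub> e \<and>
        f \<otimes>\<^bsub>R\<^esub> w = w \<otimes>\<^bsub>R\<^esub> f)"

text \<open>Here \<open>a <#\<^bsub>R\<^esub> carrier R\<close> is the multiplicative coset, i.e. the principal right ideal \<open>aR\<close>.\<close>

definition weakly_exchange :: "('a, 'm) ring_scheme \<Rightarrow> bool" where
  "weakly_exchange R \<longleftrightarrow>
     (\<forall>a\<in>carrier R. \<exists>e.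
        idempotent_in R e \<and>
        e \<in> a <#\<^bsub>R\<^esub> carrier R \<and>
        \<one>\<^bsub>R\<^esub> \<ominus>\<^bsub>R\<^esub> e \<in>
          ((\<one>\<^bsub>R\<^esub> \<ominus>\<^bsub>R\<^esub> a) <#\<^bsub>R\<^esub> carrier R) \<union> ((\<one>\<^bsub>R\<^esub> \<oplus>\<^bsub>R\<^esub> a) <#\<^bsub>R\<^esub> carrier R))"

text \<open>
  The library's \<^locale>\<open>ideal\<close> and \<^locale>\<open>maximalideal\<close> are two-sided, whereas the Jacobson radical
  of a noncommutative ring is the intersection of its maximal one-sided ideals
  (right ideals here; left ideals give the same set).
\<close>

definition right_ideal :: "('a, 'm) ring_scheme \<Rightarrow> 'a set \<Rightarrow> bool" where
  "right_ideal R I \<longleftrightarrow>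
     additive_subgroup I R \<and> (\<forall>x\<in>I. \<forall>r\<in>carrier R. x \<otimes>\<^bsub>R\<^esub> r \<in> I)"

definition maximal_right_ideal :: "('a, 'm) ring_scheme \<Rightarrow> 'a set \<Rightarrow> bool" where
  "maximal_right_ideal R M \<longleftrightarrow>
     right_ideal R M \<and> M \<noteq> carrier R \<and>
     (\<forall>I. right_ideal R I \<and> M \<subseteq> I \<longrightarrow> I = M \<or> I = carrier R)"

text \<open>Intersecting with the carrier makes \<open>J(0) = 0\<close>, as the zero ring has no maximal right ideal.\<close>

definition jacobson_radical :: "('a, 'm) ring_scheme \<Rightarrow> 'a set" where
  "jacobson_radical R = carrier R \<inter> \<Inter> {M. maximal_right_ideal R M}"

end

theory Submission
  imports Defs
begin

text \<open>
  Both sides are compared with a third condition, that \<open>a\<^sup>3 - a\<close> is nilpotent for every \<open>a\<close>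
  (\<open>nil_tripotent\<close> below).

  Its equivalence with being strongly 2-nil-clean is a computation with commuting elements. If
  \<open>3 = e + f + w\<close> is a decomposition of the element 3, then \<open>6\<close> turns out to be a multiple of \<open>w\<close>, hence
  nilpotent; and for \<open>a = e + f + w\<close> one has \<open>a\<^sup>3 - a = 6ef\<close> up to a multiple of \<open>w\<close>. Conversely, the
  subring generated by \<open>a\<close> is modulo nilpotents a subring of a product of copies of \<open>\<int>/2\<close> and \<open>\<int>/3\<close>,
  where \<open>a\<^sup>2\<close> and \<open>2(a\<^sup>2 - a)\<close> are idempotents with sum \<open>a\<close>; both lift to idempotents that commute with
  each other and with \<open>a\<close>. Lifting \<open>a\<^sup>2\<close> to \<open>e \<in> aR\<close> with \<open>1 - e \<in> (1 - a)R\<close> also gives the exchange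
  property.

  The rest takes place in \<open>S = R/J(R)\<close>, whose radical is zero. The link between the two sides is
  that every nonzero principal right ideal of \<open>S\<close> contains a nonzero idempotent
  (\<open>idempotent_rich\<close>). This follows from nil tripotence by lifting, and it follows from the weak
  exchange property together with \<open>u\<^sup>2 = 1\<close> for units by a short argument that kills \<open>3x\<close> and then \<open>x\<close> for
  every element of a right ideal without idempotents.

  Suppose moreover that \<open>u\<^sup>2 - 1\<close> is nilpotent for every unit \<open>u\<close>, as is the case under either
  hypothesis. Then \<open>S\<close> is reduced (\<open>reduced_if_idempotent_rich\<close>): an element \<open>w \<noteq> 0\<close> of square zero
  with a nonzero idempotent \<open>e \<in> wS\<close> yields a system of 2 by 2 matrix units with corner \<open>e\<close>, and there
  the matrix with rows \<open>(1, 1)\<close> and \<open>(1, 0)\<close> extends to a unit violating the assumption. In a reduced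
  ring the nilpotent \<open>u\<^sup>2 - 1\<close> vanishes, which is the exponent condition; and in a reduced ring with
  enough idempotents, all central, the exponent condition forces \<open>a\<^sup>3 = a\<close>
  (\<open>tripotent_if_reduced_idempotent_rich\<close>). If \<open>J(R)\<close> is nil, this says that \<open>a\<^sup>3 - a\<close> is nilpotent in
  \<open>R\<close>.
\<close>

section \<open>Commuting idempotents and nilpotents\<close>

context ring begin

text \<open>
  The factored form keeps normal forms short: a sum of six ones would distribute over every product.
\<close>

abbreviation six where "six \<equiv> (\<one> \<oplus> \<one>) \<otimes> (\<one> \<oplus> \<one> \<oplus> \<one>)"

lemma nilpotent_square:
  assumes "x \<in> carrier R" "nilpotent_in R (x \<otimes> x)" shows "nilpotent_in R x"
proof -
  obtain n :: nat where "(x \<otimes> x) [^] n = \<zero>" using assms by (auto simp: nilpotent_in_def)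
  moreover have "x \<otimes> x = x [^] (2::nat)" using assms(1) by (simp add: numeral_2_eq_2)
  ultimately have "x [^] (2 * n) = \<zero>" using assms(1) by (simp add: nat_pow_pow)
  with assms(1) show ?thesis unfolding nilpotent_in_def by blast
qed

lemma idempotent_power:
  assumes "x \<in> carrier R" "x \<otimes> x = x" shows "x [^] Suc n = x"
  using assms by (induction n) auto

lemma nilpotent_idempotent_zero:
  assumes "nilpotent_in R x" "x \<otimes> x = x" shows "x = \<zero>"
proof -
  obtain n :: nat where x: "x \<in> carrier R" "x [^] n = \<zero>"
    using assms by (auto simp: nilpotent_in_def)
  then have "x [^] Suc n = \<zero>" by simp
  with idempotent_power[OF x(1) assms(2), of n] show ?thesis by simp
qed

lemma nilpotent_minus:
  assumes "nilpotent_in R x" shows "nilpotent_in R (\<ominus> x)"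
proof -
  obtain n :: nat where x: "x \<in> carrier R" "x [^] n = \<zero>"
    using assms by (auto simp: nilpotent_in_def)
  have "(\<ominus> x) [^] k = x [^] k \<or> (\<ominus> x) [^] k = \<ominus> (x [^] k)" for k :: nat
    by (induction k) (use x(1) in \<open>auto simp: l_minus r_minus\<close>)
  with x have "(\<ominus> x) [^] n = \<zero>" by (metis minus_zero)
  with x(1) show ?thesis unfolding nilpotent_in_def by blast
qed

end

context cring begin

lemma nilpotent_mult:
  assumes "nilpotent_in R x" "y \<in> carrier R" shows "nilpotent_in R (x \<otimes> y)"
proof -
  obtain n :: nat where x: "x \<in> carrier R" "x [^] n = \<zero>"
    using assms by (auto simp: nilpotent_in_def)
  then have "(x \<otimes> y) [^] n = \<zero>" using assms(2) by (simp add: nat_pow_distrib)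
  with x(1) assms(2) show ?thesis unfolding nilpotent_in_def by blast
qed

lemma nilpotent_add:
  assumes "nilpotent_in R x" "nilpotent_in R y" shows "nilpotent_in R (x \<oplus> y)"
proof -
  obtain m n :: nat where xy: "x \<in> carrier R" "y \<in> carrier R" and m: "x [^] m = \<zero>" and n: "y [^] n = \<zero>"
    using assms by (auto simp: nilpotent_in_def)
  have pow_zero: "z [^] i = \<zero>" if "z [^] k = \<zero>" "k \<le> i" "z \<in> carrier R" for z and i k :: nat
    using that by (metis nat_pow_closed le_add_diff_inverse nat_pow_mult l_null)
  (* The factors x^i and y^j are what makes an induction on the exponent of x + y possible,
     without the binomial theorem. *)
  have "x [^] i \<otimes> y [^] j \<otimes> (x \<oplus> y) [^] k = \<zero>" if "i + j + k \<ge> m + n" for i j k :: nat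
    using that
  proof (induction k arbitrary: i j)
    case 0
    then have "m \<le> i \<or> n \<le> j" by auto
    then have "x [^] i = \<zero> \<or> y [^] j = \<zero>" using m n pow_zero xy by blast
    with xy show ?case by auto
  next
    case (Suc k)
    let ?s = "(x \<oplus> y) [^] k"
    have "x [^] i \<otimes> y [^] j \<otimes> (x \<oplus> y) [^] Suc k
        = x [^] Suc i \<otimes> y [^] j \<otimes> ?s \<oplus> x [^] i \<otimes> y [^] Suc j \<otimes> ?s"
      using xy by (simp add: l_distr r_distr m_ac)
    with Suc.IH[of "Suc i" j] Suc.IH[of i "Suc j"] Suc.prems show ?case by simp
  qed
  from this[of 0 0 "m + n"] xy have "(x \<oplus> y) [^] (m + n) = \<zero>" by simp
  with xy show ?thesis unfolding nilpotent_in_def by blast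
qed

lemma nilpotent_carrier: "nilpotent_in R x \<Longrightarrow> x \<in> carrier R"
  by (simp add: nilpotent_in_def)

text \<open>
  Newton iteration \<open>x \<mapsto> 3x\<^sup>2 - 2x\<^sup>3\<close>, written with \<open>y = 1 - x\<close>: the new pair \<open>x\<^sup>2(1 + 2y)\<close>,
  \<open>y\<^sup>2(1 + 2x)\<close> has again sum 1, and its product is a multiple of \<open>(xy)\<^sup>2\<close>, so the nilpotency exponent of
  \<open>xy\<close> is halved. The symmetric form shows at once that the limit is a multiple of \<open>x\<close> and its
  complement a multiple of \<open>y\<close>.
\<close>

lemma lift_idempotent_pow:
  assumes "x \<in> carrier R" "y \<in> carrier R" "x \<oplus> y = \<one>" "(x \<otimes> y) [^] ((2::nat) ^ k) = \<zero>"
  shows "\<exists>r\<in>carrier R. \<exists>s\<in>carrier R. \<exists>t\<in>carrier R.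
    idempotent_in R (x \<otimes> r) \<and> x \<otimes> r \<oplus> y \<otimes> s = \<one> \<and> x \<otimes> r = x \<oplus> x \<otimes> y \<otimes> t"
  using assms
proof (induction k arbitrary: x y)
  case 0
  then have xy: "x \<otimes> y = \<zero>" by simp
  have "x \<otimes> x \<oplus> x \<otimes> y = x" using 0(1-3) by (metis r_distr r_one)
  then have "x \<otimes> x = x" using 0(1) xy by simp
  then show ?case using 0 xy
    by (intro bexI[of _ \<one>]) (auto simp: idempotent_in_def)
next
  case (Suc k)
  note c = Suc.prems(1,2)
  let ?p = "\<one> \<oplus> (y \<oplus> y)" and ?q = "\<one> \<oplus> (x \<oplus> x)"
  let ?x = "x \<otimes> (x \<otimes> ?p)" and ?y = "y \<otimes> (y \<otimes> ?q)"
  have "?x \<oplus> ?y = (x \<oplus> y) \<otimes> (x \<oplus> y) \<oplus> (x \<oplus> y \<ominus> \<one>) \<otimes> (x \<otimes> y \<oplus> x \<otimes> y)"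
    using c by algebra
  then have sum: "?x \<oplus> ?y = \<one>" using Suc.prems(3) c by (simp add: minus_eq r_neg)
  have prod: "?x \<otimes> ?y = ((x \<otimes> y) \<otimes> (x \<otimes> y)) \<otimes> (?p \<otimes> ?q)"
    using c by (simp add: m_ac)
  have "((x \<otimes> y) \<otimes> (x \<otimes> y)) [^] ((2::nat) ^ k) = \<zero>"
    using Suc.prems c by (simp add: nat_pow_distrib power_Suc mult_2 flip: nat_pow_mult)
  then have "(?x \<otimes> ?y) [^] ((2::nat) ^ k) = \<zero>"
    unfolding prod using c by (simp add: nat_pow_distrib)
  from Suc.IH[OF _ _ sum this] c obtain r s t where rst: "r \<in> carrier R" "s \<in> carrier R" "t \<in> carrier R"
    and e: "idempotent_in R (?x \<otimes> r)" "?x \<otimes> r \<oplus> ?y \<otimes> s = \<one>" "?x \<otimes> r = ?x \<oplus> ?x \<otimes> ?y \<otimes> t"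
    by auto
  have xx: "?x = x \<oplus> x \<otimes> y \<otimes> (x \<oplus> x \<ominus> \<one>) \<oplus> x \<otimes> (x \<oplus> y \<ominus> \<one>)"
    using c by algebra
  have xx: "?x = x \<oplus> x \<otimes> y \<otimes> (x \<oplus> x \<ominus> \<one>)"
    using c Suc.prems(3) by (subst xx) (simp add: minus_eq r_neg)
  have er: "?x \<otimes> r = x \<otimes> (x \<otimes> ?p \<otimes> r)" "?y \<otimes> s = y \<otimes> (y \<otimes> ?q \<otimes> s)"
    using c rst by (simp_all add: m_assoc)
  have factor: "k \<oplus> p \<otimes> h \<oplus> p \<otimes> p \<otimes> m \<otimes> t = k \<oplus> p \<otimes> (h \<oplus> p \<otimes> m \<otimes> t)"
    if "k \<in> carrier R" "p \<in> carrier R" "h \<in> carrier R" "m \<in> carrier R" for k p h m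
    using that rst(3) by algebra
  have "?x \<otimes> r = (x \<oplus> x \<otimes> y \<otimes> (x \<oplus> x \<ominus> \<one>)) \<oplus> ((x \<otimes> y) \<otimes> (x \<otimes> y)) \<otimes> (?p \<otimes> ?q) \<otimes> t"
    using e(3) by (simp only: prod xx[symmetric])
  also have "\<dots> = x \<oplus> x \<otimes> y \<otimes> ((x \<oplus> x \<ominus> \<one>) \<oplus> x \<otimes> y \<otimes> (?p \<otimes> ?q) \<otimes> t)"
    using c by (intro factor) simp_all
  finally have et: "?x \<otimes> r = x \<oplus> x \<otimes> y \<otimes> ((x \<oplus> x \<ominus> \<one>) \<oplus> x \<otimes> y \<otimes> (?p \<otimes> ?q) \<otimes> t)" .
  show ?case
    by (intro bexI[of _ "x \<otimes> ?p \<otimes> r"] bexI[of _ "y \<otimes> ?q \<otimes> s"]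
        bexI[of _ "(x \<oplus> x \<ominus> \<one>) \<oplus> x \<otimes> y \<otimes> (?p \<otimes> ?q) \<otimes> t"])
      (use c rst e et in \<open>simp_all flip: er\<close>)
qed

lemma lift_idempotent:
  assumes "x \<in> carrier R" "y \<in> carrier R" "x \<oplus> y = \<one>" "nilpotent_in R (x \<otimes> y)"
  obtains e r s w where "idempotent_in R e" "r \<in> carrier R" "s \<in> carrier R" "nilpotent_in R w"
    "e = x \<otimes> r" "e \<oplus> y \<otimes> s = \<one>" "e \<oplus> w = x"
proof -
  obtain n :: nat where n: "(x \<otimes> y) [^] n = \<zero>" using assms by (auto simp: nilpotent_in_def)
  have "(x \<otimes> y) [^] (n + (2 ^ n - n)) = \<zero>"
    using n assms(1,2) by (subst nat_pow_mult[symmetric]) auto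
  then have "(x \<otimes> y) [^] ((2::nat) ^ n) = \<zero>" by simp
  from lift_idempotent_pow[OF assms(1-3) this] obtain r s t where
    rst: "r \<in> carrier R" "s \<in> carrier R" "t \<in> carrier R"
    "idempotent_in R (x \<otimes> r)" "x \<otimes> r \<oplus> y \<otimes> s = \<one>" "x \<otimes> r = x \<oplus> x \<otimes> y \<otimes> t" by blast
  have "nilpotent_in R (\<ominus> (x \<otimes> y \<otimes> t))"
    using nilpotent_minus nilpotent_mult assms(4) rst(3) by blast
  moreover have "x \<otimes> r \<oplus> \<ominus> (x \<otimes> y \<otimes> t) = x"
    unfolding rst(6) using assms(1,2) rst(3) by algebra
  ultimately show ?thesis using rst that by blast
qed

text \<open>
  Multiplying \<open>w = 3 - e - f\<close> by \<open>ef\<close> gives \<open>ef\<close>, which is thus nilpotent and idempotent, hence zero.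
  So \<open>g = e + f\<close> is idempotent, and \<open>(3 - g)(2 + g) = 6\<close>.
\<close>

lemma six_nilpotent:
  assumes "idempotent_in R e" "idempotent_in R f" "nilpotent_in R w"
    and three: "\<one> \<oplus> \<one> \<oplus> \<one> = e \<oplus> f \<oplus> w"
  shows "nilpotent_in R six"
proof -
  note c = assms(1)[unfolded idempotent_in_def, THEN conjunct1]
    assms(2)[unfolded idempotent_in_def, THEN conjunct1] nilpotent_carrier[OF assms(3)]
  note ee = assms(1)[unfolded idempotent_in_def, THEN conjunct2]
  note ff = assms(2)[unfolded idempotent_in_def, THEN conjunct2]
  have w: "w = \<one> \<oplus> \<one> \<oplus> \<one> \<ominus> e \<ominus> f"
    unfolding three using c by algebra
  have "w \<otimes> (e \<otimes> f) = e \<otimes> f \<oplus> (e \<ominus> e \<otimes> e) \<otimes> f \<oplus> e \<otimes> (f \<ominus> f \<otimes> f)"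
    unfolding w using c(1,2) by algebra
  also have "\<dots> = e \<otimes> f" using c ee ff by (simp add: minus_eq r_neg)
  finally have "nilpotent_in R (e \<otimes> f)"
    using nilpotent_mult[OF assms(3), of "e \<otimes> f"] c by simp
  moreover have "(e \<otimes> f) \<otimes> (e \<otimes> f) = (e \<otimes> e) \<otimes> (f \<otimes> f)"
    using c by (simp add: m_ac)
  ultimately have ef: "e \<otimes> f = \<zero>" using nilpotent_idempotent_zero ee ff by simp
  define g where "g = e \<oplus> f"
  have g: "g \<in> carrier R" using c by (simp add: g_def)
  have "g \<otimes> g = e \<otimes> e \<oplus> f \<otimes> f \<oplus> (e \<otimes> f \<oplus> e \<otimes> f)" unfolding g_def using c by algebra
  then have gg: "g \<otimes> g = g" using ef ee ff c by (simp add: g_def)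
  have "w = \<one> \<oplus> \<one> \<oplus> \<one> \<ominus> g" unfolding w g_def using c by algebra
  then have "w \<otimes> (\<one> \<oplus> \<one> \<oplus> g) = six \<oplus> (g \<ominus> g \<otimes> g)"
    using g by algebra
  also have "\<dots> = six" using g gg by (simp add: minus_eq r_neg)
  finally show ?thesis using nilpotent_mult[OF assms(3), of "\<one> \<oplus> \<one> \<oplus> g"] g by simp
qed

text \<open>
  With \<open>g = e + f\<close> and \<open>p = ef\<close> one has \<open>g\<^sup>2 = g + 2p\<close> and \<open>gp = 2p\<close>, so \<open>g\<^sup>3 = g + 6p\<close>, while
  \<open>a\<^sup>3 - g\<^sup>3\<close> is a multiple of \<open>a - g = w\<close>.
\<close>

lemma cube_of_two_idempotents_and_nilpotent:
  assumes "idempotent_in R e" "idempotent_in R f" "nilpotent_in R w"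
    and six: "nilpotent_in R six"
    and a: "a = e \<oplus> f \<oplus> w"
  shows "\<exists>c. nilpotent_in R c \<and> a \<otimes> (a \<otimes> a) = a \<oplus> c"
proof -
  note c = assms(1)[unfolded idempotent_in_def, THEN conjunct1]
    assms(2)[unfolded idempotent_in_def, THEN conjunct1] nilpotent_carrier[OF assms(3)]
  note ee = assms(1)[unfolded idempotent_in_def, THEN conjunct2]
  note ff = assms(2)[unfolded idempotent_in_def, THEN conjunct2]
  define g p where "g = e \<oplus> f" and "p = e \<otimes> f"
  have gp: "g \<in> carrier R" "p \<in> carrier R" using c by (simp_all add: g_def p_def)
  have "g \<otimes> g = e \<otimes> e \<oplus> f \<otimes> f \<oplus> (p \<oplus> p)" unfolding g_def p_def using c by algebra
  then have g2: "g \<otimes> g = g \<oplus> (p \<oplus> p)" by (simp add: ee ff g_def)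
  have "g \<otimes> p = (e \<otimes> e) \<otimes> f \<oplus> e \<otimes> (f \<otimes> f)" unfolding g_def p_def using c by algebra
  then have "g \<otimes> p = p \<oplus> p" by (simp add: ee ff p_def)
  then have "g \<otimes> (g \<otimes> g) = g \<oplus> (p \<oplus> p) \<oplus> ((p \<oplus> p) \<oplus> (p \<oplus> p))"
    unfolding g2 using gp by (simp add: r_distr g2)
  also have "\<dots> = g \<oplus> six \<otimes> p" using gp by algebra
  finally have g3: "g \<otimes> (g \<otimes> g) = g \<oplus> six \<otimes> p" .
  have a': "a = g \<oplus> w" "a \<in> carrier R" using a c by (simp_all add: g_def)
  have "a \<otimes> (a \<otimes> a) = (a \<ominus> g) \<otimes> (a \<otimes> a \<oplus> a \<otimes> g \<oplus> g \<otimes> g) \<oplus> g \<otimes> (g \<otimes> g)"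
    using a'(2) gp by algebra
  also have "a \<ominus> g = w" unfolding a' using gp c by algebra
  also have "w \<otimes> (a \<otimes> a \<oplus> a \<otimes> g \<oplus> g \<otimes> g) \<oplus> g \<otimes> (g \<otimes> g) =
    a \<oplus> (w \<otimes> (a \<otimes> a \<oplus> a \<otimes> g \<oplus> g \<otimes> g) \<oplus> w \<otimes> \<ominus> \<one> \<oplus> six \<otimes> p)"
  proof -
    have *: "v \<oplus> (g \<oplus> q) = g \<oplus> w \<oplus> (v \<oplus> w \<otimes> \<ominus> \<one> \<oplus> q)" if "v \<in> carrier R" "q \<in> carrier R" for v q
      using c gp that by algebra
    show ?thesis unfolding g3 using *[of "w \<otimes> (a \<otimes> a \<oplus> a \<otimes> g \<oplus> g \<otimes> g)" "six \<otimes> p"]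
      c gp a' by simp
  qed
  finally have "a \<otimes> (a \<otimes> a) = a \<oplus> (w \<otimes> (a \<otimes> a \<oplus> a \<otimes> g \<oplus> g \<otimes> g) \<oplus> w \<otimes> \<ominus> \<one> \<oplus> six \<otimes> p)" .
  moreover have "nilpotent_in R (w \<otimes> (a \<otimes> a \<oplus> a \<otimes> g \<oplus> g \<otimes> g) \<oplus> w \<otimes> \<ominus> \<one> \<oplus> six \<otimes> p)"
    by (intro nilpotent_add nilpotent_mult six assms(3)) (use c gp a' in simp_all)
  ultimately show ?thesis by blast
qed

text \<open>
  Put \<open>b = a\<^sup>2 - a\<close>. Modulo nilpotents \<open>b\<^sup>2 = 2b\<close> and \<open>6 = 0\<close>, so \<open>a\<^sup>2\<close> and \<open>z = 2b\<close> are idempotent and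
  \<open>t = 3b\<close> is zero. They satisfy \<open>a\<^sup>2 + z = a + t\<close>, so lifting \<open>a\<^sup>2\<close> and \<open>z\<close> gives the decomposition.
\<close>

lemma two_idempotents_and_nilpotent_if_cube:
  assumes a: "a \<in> carrier R" and c: "nilpotent_in R c" and a3: "a \<otimes> (a \<otimes> a) = a \<oplus> c"
    and six: "nilpotent_in R six"
  shows "\<exists>e f w. idempotent_in R e \<and> idempotent_in R f \<and> nilpotent_in R w \<and> a = e \<oplus> f \<oplus> w"
proof -
  note cc = nilpotent_carrier[OF c]
  define b d where "b = a \<otimes> a \<ominus> a" and "d = c \<otimes> (a \<ominus> (\<one> \<oplus> \<one>))"
  have bd: "b \<in> carrier R" "nilpotent_in R d" "d \<in> carrier R"
    using a c nilpotent_mult cc by (simp_all add: b_def d_def)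
  have "c = a \<otimes> (a \<otimes> a) \<ominus> a" unfolding a3 using a cc by algebra
  then have bb: "b \<otimes> b = b \<oplus> b \<oplus> d" unfolding d_def b_def using a by algebra
  define z where "z = b \<oplus> b"
  have z: "z \<in> carrier R" using bd by (simp add: z_def)
  have z3: "(\<one> \<oplus> \<one> \<oplus> \<one>) \<otimes> z = six \<otimes> b" unfolding z_def using bd
    by (simp add: l_distr a_assoc)
  have "z \<otimes> (\<one> \<ominus> z) = z \<ominus> (b \<otimes> b \<oplus> b \<otimes> b \<oplus> (b \<otimes> b \<oplus> b \<otimes> b))"
    unfolding z_def using bd by algebra
  also have "\<dots> = \<ominus> ((\<one> \<oplus> \<one> \<oplus> \<one>) \<otimes> z) \<oplus> d \<otimes> \<ominus> (\<one> \<oplus> \<one> \<oplus> \<one> \<oplus> \<one>)"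
    unfolding bb z_def[symmetric] using bd z by algebra
  finally have znil: "nilpotent_in R (z \<otimes> (\<one> \<ominus> z))"
    unfolding z3 using bd six by (auto intro!: nilpotent_add nilpotent_mult nilpotent_minus)
  have z1: "z \<oplus> (\<one> \<ominus> z) = \<one>" using z by algebra
  obtain f v where f: "idempotent_in R f" "nilpotent_in R v" "f \<oplus> v = z"
    using lift_idempotent[OF z minus_closed[OF one_closed z] z1 znil] by metis
  define x where "x = a \<otimes> a"
  have x: "x \<in> carrier R" using a by (simp add: x_def)
  have "x \<otimes> (\<one> \<ominus> x) = a \<otimes> a \<ominus> a \<otimes> (a \<otimes> (a \<otimes> a))" unfolding x_def using a by algebra
  also have "\<dots> = c \<otimes> \<ominus> a" unfolding a3 using a cc by algebra
  finally have xnil: "nilpotent_in R (x \<otimes> (\<one> \<ominus> x))" using nilpotent_mult[OF c, of "\<ominus> a"] a by simp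
  have x1: "x \<oplus> (\<one> \<ominus> x) = \<one>" using x by algebra
  obtain e u where e: "idempotent_in R e" "nilpotent_in R u" "e \<oplus> u = x"
    using lift_idempotent[OF x minus_closed[OF one_closed x] x1 xnil] by metis
  define t where "t = b \<oplus> b \<oplus> b"
  have tc: "t \<in> carrier R" using bd by (simp add: t_def)
  have "t \<otimes> t = (\<one> \<oplus> \<one> \<oplus> \<one>) \<otimes> (b \<otimes> b \<oplus> b \<otimes> b \<oplus> b \<otimes> b)" unfolding t_def using bd by algebra
  also have "b \<otimes> b \<oplus> b \<otimes> b \<oplus> b \<otimes> b = (\<one> \<oplus> \<one>) \<otimes> t \<oplus> d \<otimes> (\<one> \<oplus> \<one> \<oplus> \<one>)"
    unfolding bb t_def using bd(1,3) by (simp add: l_distr r_distr a_ac)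
  also have "(\<one> \<oplus> \<one> \<oplus> \<one>) \<otimes> ((\<one> \<oplus> \<one>) \<otimes> t \<oplus> d \<otimes> (\<one> \<oplus> \<one> \<oplus> \<one>)) = six \<otimes> t \<oplus> d \<otimes> ((\<one> \<oplus> \<one> \<oplus> \<one>) \<otimes> (\<one> \<oplus> \<one> \<oplus> \<one>))"
  proof -
    have "k \<otimes> (l \<otimes> t \<oplus> d \<otimes> k) = l \<otimes> k \<otimes> t \<oplus> d \<otimes> (k \<otimes> k)"
    if "k \<in> carrier R" "l \<in> carrier R" for k l
      using that tc bd(3) by algebra
    then show ?thesis by simp
  qed
  finally have "nilpotent_in R (t \<otimes> t)"
    using bd tc six by (auto intro!: nilpotent_add nilpotent_mult)
  then have t: "nilpotent_in R t" "t \<in> carrier R" using nilpotent_square tc by blast+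
  have ec: "e \<in> carrier R" "f \<in> carrier R" "u \<in> carrier R" "v \<in> carrier R"
    using e f by (auto simp: idempotent_in_def nilpotent_carrier)
  have "a \<otimes> a = a \<oplus> b" unfolding b_def using a by algebra
  then have "x \<oplus> z \<ominus> t = a" unfolding x_def z_def t_def using a bd(1) by algebra
  then have "a = e \<oplus> u \<oplus> (f \<oplus> v) \<ominus> t" unfolding e f by simp
  also have "\<dots> = e \<oplus> f \<oplus> (u \<oplus> v \<oplus> \<ominus> t)" using ec t(2) by algebra
  finally show ?thesis using e f t
    by (intro exI[of _ e] exI[of _ f] exI[of _ "u \<oplus> v \<oplus> \<ominus> t"]) (auto intro!: nilpotent_add nilpotent_minus)
qed

end

section \<open>Nil tripotent rings\<close>

text \<open>
  The difference \<open>a\<^sup>3 - a\<close> appears as the summand \<open>c\<close> so that the condition reads the same in a subring,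
  where subtraction is formally a different operation.
\<close>

definition nil_tripotent :: "('a, 'm) ring_scheme \<Rightarrow> bool" where
  "nil_tripotent R \<longleftrightarrow> (\<forall>a\<in>carrier R. \<exists>c. nilpotent_in R c \<and>
     a \<otimes>\<^bsub>R\<^esub> (a \<otimes>\<^bsub>R\<^esub> a) = a \<oplus>\<^bsub>R\<^esub> c)"

definition commutant :: "('a, 'm) ring_scheme \<Rightarrow> 'a set \<Rightarrow> 'a set" where
  "commutant R T = {x \<in> carrier R. \<forall>t\<in>T. x \<otimes>\<^bsub>R\<^esub> t = t \<otimes>\<^bsub>R\<^esub> x}"

context ring begin

lemma subring_commutant:
  assumes "T \<subseteq> carrier R" shows "subring (commutant R T) R"
proof (rule subringI)
  fix x y assume xy: "x \<in> commutant R T" "y \<in> commutant R T"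
  show "x \<otimes> y \<in> commutant R T"
  proof -
    have "x \<otimes> y \<otimes> t = t \<otimes> (x \<otimes> y)" if "t \<in> T" for t
      using xy that assms unfolding commutant_def by (smt (verit) m_assoc mem_Collect_eq subsetD)
    then show ?thesis using xy by (auto simp: commutant_def)
  qed
qed (use assms in \<open>auto simp: commutant_def l_minus r_minus l_distr r_distr subset_iff\<close>)

text \<open>
  The double commutant of a commuting set is commutative. It reduces statements about commuting
  elements of a noncommutative ring to commutative ones.
\<close>

lemma commuting_set_in_subcring:
  assumes "T \<subseteq> carrier R" "\<And>x y. x \<in> T \<Longrightarrow> y \<in> T \<Longrightarrow> x \<otimes> y = y \<otimes> x"
  obtains C where "subcring C R" "T \<subseteq> C"
proof
  let ?C = "commutant R (commutant R T)"
  have sub: "commutant R T \<subseteq> carrier R" by (auto simp: commutant_def)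
  show "T \<subseteq> ?C" using assms(1) by (auto simp: commutant_def)
  have "?C \<subseteq> commutant R T" using assms by (auto simp: commutant_def)
  then show "subcring ?C R"
    by (intro subcringI subring_commutant sub) (auto simp: commutant_def)
qed

lemma nilpotent_in_subring:
  assumes "subring C R"
  shows "nilpotent_in (R\<lparr>carrier := C\<rparr>) x \<longleftrightarrow> x \<in> C \<and> nilpotent_in R x"
  using subringE(1)[OF assms] by (auto simp: nilpotent_in_def nat_pow_consistent[symmetric])

lemma idempotent_in_subring:
  assumes "subring C R"
  shows "idempotent_in (R\<lparr>carrier := C\<rparr>) x \<longleftrightarrow> x \<in> C \<and> idempotent_in R x"
  using subringE(1)[OF assms] by (auto simp: idempotent_in_def)

lemma cring_subcring: "subcring C R \<Longrightarrow> cring (R\<lparr>carrier := C\<rparr>)"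
  using subcring_iff subcring.axioms(1) subringE(1) by blast

text \<open>Two elements with sum 1 commute, so the iteration can be carried out in a commutative subring.\<close>

lemma lift_idempotent_complementary:
  assumes "x \<in> carrier R" "y \<in> carrier R" "x \<oplus> y = \<one>" "nilpotent_in R (x \<otimes> y)"
  obtains e r s w where "idempotent_in R e" "r \<in> carrier R" "s \<in> carrier R" "nilpotent_in R w"
    "e = x \<otimes> r" "e \<oplus> y \<otimes> s = \<one>" "e \<oplus> w = x"
proof -
  have "x \<otimes> x \<oplus> x \<otimes> y = x \<otimes> x \<oplus> y \<otimes> x"
    using assms(1-3) by (metis l_distr r_distr l_one r_one)
  then have comm: "x \<otimes> y = y \<otimes> x" using assms(1,2) by simp
  obtain C where C: "subcring C R" "{x, y} \<subseteq> C"
    by (rule commuting_set_in_subcring[of "{x, y}"]) (use assms(1,2) comm in auto)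
  note sub = subcring.axioms(1)[OF C(1)]
  have "nilpotent_in (R\<lparr>carrier := C\<rparr>) (x \<otimes> y)"
    using C assms(4) subringE(6)[OF sub] by (simp add: nilpotent_in_subring[OF sub])
  then obtain e r s w where "idempotent_in (R\<lparr>carrier := C\<rparr>) e" "r \<in> C" "s \<in> C" "nilpotent_in (R\<lparr>carrier := C\<rparr>) w"
    "e = x \<otimes> r" "e \<oplus> y \<otimes> s = \<one>" "e \<oplus> w = x"
    using cring.lift_idempotent[OF cring_subcring[OF C(1)], of x y, simplified] C(2) assms(3)
    by (metis insert_subset)
  moreover from this have "idempotent_in R e" "nilpotent_in R w" "r \<in> carrier R" "s \<in> carrier R"
    using subringE(1)[OF sub] by (auto simp: nilpotent_in_subring[OF sub] idempotent_in_subring[OF sub])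
  ultimately show ?thesis using that by metis
qed

text \<open>The decomposition of the single element 3 already makes 6 nilpotent.\<close>

lemma nil_tripotent_if_strongly_2_nil_clean:
  assumes "strongly_2_nil_clean R" shows "nil_tripotent R"
proof -
  have decompose: "\<exists>C e f w. subcring C R \<and> {a, e, f, w} \<subseteq> C \<and> idempotent_in (R\<lparr>carrier := C\<rparr>) e \<and>
      idempotent_in (R\<lparr>carrier := C\<rparr>) f \<and> nilpotent_in (R\<lparr>carrier := C\<rparr>) w \<and> a = e \<oplus> f \<oplus> w"
    if "a \<in> carrier R" for a
  proof -
    obtain e f w where efw: "idempotent_in R e" "idempotent_in R f" "nilpotent_in R w"
        "a = e \<oplus> f \<oplus> w" "e \<otimes> f = f \<otimes> e" "e \<otimes> w = w \<otimes> e" "f \<otimes> w = w \<otimes> f"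
      using bspec[OF assms[unfolded strongly_2_nil_clean_def] \<open>a \<in> carrier R\<close>] by (elim exE conjE)
    obtain C where C: "subcring C R" "{e, f, w} \<subseteq> C"
      by (rule commuting_set_in_subcring[of "{e, f, w}"])
         (use efw in \<open>auto simp: idempotent_in_def nilpotent_in_def\<close>)
    note sub = subcring.axioms(1)[OF C(1)]
    have "a \<in> C" using C(2) subringE(7)[OF sub] efw(4) by simp
    then show ?thesis using C efw(1-4)
      by (intro exI[of _ C] exI[of _ e] exI[of _ f] exI[of _ w])
         (auto simp: idempotent_in_subring[OF sub] nilpotent_in_subring[OF sub])
  qed
  have six: "nilpotent_in R six"
  proof -
    obtain C e f w where C: "subcring C R" and "idempotent_in (R\<lparr>carrier := C\<rparr>) e"
      "idempotent_in (R\<lparr>carrier := C\<rparr>) f" "nilpotent_in (R\<lparr>carrier := C\<rparr>) w" "\<one> \<oplus> \<one> \<oplus> \<one> = e \<oplus> f \<oplus> w"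
      using decompose[of "\<one> \<oplus> \<one> \<oplus> \<one>"] by auto
    then have "nilpotent_in (R\<lparr>carrier := C\<rparr>) six"
      using cring.six_nilpotent[OF cring_subcring[OF C], of e f w] by simp
    then show ?thesis by (simp add: nilpotent_in_subring[OF subcring.axioms(1)[OF C]])
  qed
  show ?thesis unfolding nil_tripotent_def
  proof
    fix a assume "a \<in> carrier R"
    then obtain C e f w where C: "subcring C R" and efw: "idempotent_in (R\<lparr>carrier := C\<rparr>) e"
      "idempotent_in (R\<lparr>carrier := C\<rparr>) f" "nilpotent_in (R\<lparr>carrier := C\<rparr>) w" "a = e \<oplus> f \<oplus> w"
      using decompose by meson
    note sub = subcring.axioms(1)[OF C]
    have "nilpotent_in (R\<lparr>carrier := C\<rparr>) six"
      using six subringE(3,6,7)[OF sub] by (simp add: nilpotent_in_subring[OF sub])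
    with cring.cube_of_two_idempotents_and_nilpotent[OF cring_subcring[OF C], of e f w a] efw
    have "\<exists>c. nilpotent_in (R\<lparr>carrier := C\<rparr>) c \<and> a \<otimes> (a \<otimes> a) = a \<oplus> c" by simp
    then show "\<exists>c. nilpotent_in R c \<and> a \<otimes> (a \<otimes> a) = a \<oplus> c"
      by (auto simp: nilpotent_in_subring[OF sub])
  qed
qed

text \<open>Here 6 is nilpotent because it is \<open>2\<^sup>3 - 2\<close>.\<close>

lemma strongly_2_nil_clean_if_nil_tripotent:
  assumes "nil_tripotent R" shows "strongly_2_nil_clean R"
  unfolding strongly_2_nil_clean_def
proof
  fix a assume a: "a \<in> carrier R"
  obtain d where d: "nilpotent_in R d" "(\<one> \<oplus> \<one>) \<otimes> ((\<one> \<oplus> \<one>) \<otimes> (\<one> \<oplus> \<one>)) = (\<one> \<oplus> \<one>) \<oplus> d"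
    using assms unfolding nil_tripotent_def by (meson a_closed one_closed)
  have dc: "d \<in> carrier R" using d(1) by (simp add: nilpotent_in_def)
  have "d = (\<one> \<oplus> \<one>) \<otimes> ((\<one> \<oplus> \<one>) \<otimes> (\<one> \<oplus> \<one>)) \<ominus> (\<one> \<oplus> \<one>)"
    unfolding d(2) using dc by algebra
  also have "\<dots> = six" by algebra
  finally have six: "nilpotent_in R six" using d(1) by simp
  obtain c where c: "nilpotent_in R c" "a \<otimes> (a \<otimes> a) = a \<oplus> c"
    using assms a unfolding nil_tripotent_def by blast
  have cc: "c \<in> carrier R" using c(1) by (simp add: nilpotent_in_def)
  obtain C where C: "subcring C R" "{a} \<subseteq> C"
    by (rule commuting_set_in_subcring[of "{a}"]) (use a in auto)
  note sub = subcring.axioms(1)[OF C(1)]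
  have "c = \<ominus> a \<oplus> a \<otimes> (a \<otimes> a)" unfolding c(2) using a cc by algebra
  with C(2) have "c \<in> C" by (simp add: subringE(5-7)[OF sub])
  have "\<exists>e f w. idempotent_in (R\<lparr>carrier := C\<rparr>) e \<and> idempotent_in (R\<lparr>carrier := C\<rparr>) f \<and>
      nilpotent_in (R\<lparr>carrier := C\<rparr>) w \<and> a = e \<oplus> f \<oplus> w"
    using cring.two_idempotents_and_nilpotent_if_cube[OF cring_subcring[OF C(1)], of a c]
      C(2) c six \<open>c \<in> C\<close> subringE(3,6,7)[OF sub]
    by (simp add: nilpotent_in_subring[OF sub])
  then obtain e f w where "idempotent_in R e" "idempotent_in R f" "nilpotent_in R w" "a = e \<oplus> f \<oplus> w"
    and "e \<in> C" "f \<in> C" "w \<in> C"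
    by (auto simp: nilpotent_in_subring[OF sub] idempotent_in_subring[OF sub])
  with subcring.sub_m_comm[OF C(1)] show "\<exists>e f w. idempotent_in R e \<and> idempotent_in R f \<and> nilpotent_in R w \<and>
      a = e \<oplus> f \<oplus> w \<and> e \<otimes> f = f \<otimes> e \<and> e \<otimes> w = w \<otimes> e \<and> f \<otimes> w = w \<otimes> f"
    by blast
qed

text \<open>
  Since \<open>a\<^sup>2(1 - a\<^sup>2) = -(a\<^sup>3 - a)a\<close> is nilpotent, \<open>a\<^sup>2\<close> lifts to an idempotent \<open>e \<in> a\<^sup>2R\<close> with
  \<open>1 - e \<in> (1 - a\<^sup>2)R\<close>. The difference \<open>w = a\<^sup>2 - e\<close> shows that \<open>a\<close> is nilpotent if \<open>e = 0\<close>.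
\<close>

lemma nil_tripotent_square_lift:
  assumes "nil_tripotent R" "a \<in> carrier R"
  obtains e r s w where "idempotent_in R e" "r \<in> carrier R" "s \<in> carrier R" "nilpotent_in R w"
    "e = a \<otimes> r" "\<one> \<ominus> e = (\<one> \<ominus> a) \<otimes> s" "e \<oplus> w = a \<otimes> a"
proof -
  obtain c where c: "nilpotent_in R c" "a \<otimes> (a \<otimes> a) = a \<oplus> c"
    using assms unfolding nil_tripotent_def by blast
  note a = assms(2)
  let ?x = "a \<otimes> a" and ?y = "\<one> \<ominus> a \<otimes> a"
  have cc: "c \<in> carrier R" using c(1) by (simp add: nilpotent_in_def)
  have cd: "c = a \<otimes> (a \<otimes> a) \<ominus> a" unfolding c(2) using a cc by algebra
  have "?x \<otimes> ?y = \<ominus> (c \<otimes> a)" unfolding cd using a by (simp add: ring_simprules)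
  moreover have "nilpotent_in R (c \<otimes> a)"
  proof -
    have ca: "c \<otimes> a = a \<otimes> c" unfolding cd using a by algebra
    obtain n :: nat where "c [^] n = \<zero>" using c by (auto simp: nilpotent_in_def)
    then have "(c \<otimes> a) [^] n = \<zero>" using pow_mult_distrib[OF ca cc a] a by simp
    then show ?thesis using a cc by (auto simp: nilpotent_in_def)
  qed
  ultimately have nil: "nilpotent_in R (?x \<otimes> ?y)" using nilpotent_minus by simp
  have sum: "?x \<oplus> ?y = \<one>" using a by algebra
  obtain e r s w where e: "idempotent_in R e" "r \<in> carrier R" "s \<in> carrier R" "nilpotent_in R w"
    "e = ?x \<otimes> r" "e \<oplus> ?y \<otimes> s = \<one>" "e \<oplus> w = ?x"
    by (rule lift_idempotent_complementary[OF _ _ sum nil]) (use a in auto)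
  show ?thesis
  proof (rule that)
    show "e = a \<otimes> (a \<otimes> r)" using a e by (simp add: m_assoc)
    have ec: "e \<in> carrier R" using e(1) by (simp add: idempotent_in_def)
    have "e \<oplus> k \<ominus> e = k" if "k \<in> carrier R" for k using ec that by algebra
    from this[of "?y \<otimes> s"] have "\<one> \<ominus> e = ?y \<otimes> s" using e(3,6) a by simp
    also have "\<dots> = (\<one> \<ominus> a) \<otimes> ((\<one> \<oplus> a) \<otimes> s)" using a e(3) by algebra
    finally show "\<one> \<ominus> e = (\<one> \<ominus> a) \<otimes> ((\<one> \<oplus> a) \<otimes> s)" .
  qed (use e a in auto)
qed

lemma weakly_exchange_if_nil_tripotent:
  assumes "nil_tripotent R" shows "weakly_exchange R"
  unfolding weakly_exchange_def
proof
  fix a assume a: "a \<in> carrier R"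
  obtain e r s w where "idempotent_in R e" "r \<in> carrier R" "s \<in> carrier R" "nilpotent_in R w"
    "e = a \<otimes> r" "\<one> \<ominus> e = (\<one> \<ominus> a) \<otimes> s" "e \<oplus> w = a \<otimes> a"
    by (rule nil_tripotent_square_lift[OF assms a])
  then show "\<exists>e. idempotent_in R e \<and> e \<in> a <# carrier R \<and>
      \<one> \<ominus> e \<in> ((\<one> \<ominus> a) <# carrier R) \<union> ((\<one> \<oplus> a) <# carrier R)"
    by (intro exI[of _ e]) (auto simp: l_coset_def)
qed

end

section \<open>The Jacobson radical\<close>

definition right_invertible_in :: "('a, 'm) ring_scheme \<Rightarrow> 'a \<Rightarrow> bool" where
  "right_invertible_in R x \<longleftrightarrow> (\<exists>y\<in>carrier R. x \<otimes>\<^bsub>R\<^esub> y = \<one>\<^bsub>R\<^esub>)"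

context ring begin

lemma right_ideal_principal:
  assumes "x \<in> carrier R" shows "right_ideal R (x <# carrier R)"
  unfolding right_ideal_def
proof (intro conjI ballI)
  show "additive_subgroup (x <# carrier R) R"
  proof (intro additive_subgroup.intro, rule group.subgroupI)
    show "Group.group (add_monoid R)" by (rule a_group)
    fix u assume "u \<in> x <# carrier R"
    then obtain r where r: "r \<in> carrier R" "u = x \<otimes> r" by (auto simp: l_coset_def)
    then have "\<ominus> u = x \<otimes> \<ominus> r" using assms by (simp add: r_minus)
    with r show "inv\<^bsub>add_monoid R\<^esub> u \<in> x <# carrier R" by (auto simp: l_coset_def a_inv_def)
    fix v assume "v \<in> x <# carrier R"
    then obtain s where s: "s \<in> carrier R" "v = x \<otimes> s" by (auto simp: l_coset_def)
    then have "u \<oplus> v = x \<otimes> (r \<oplus> s)" using assms r by (simp add: r_distr)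
    with r s show "u \<otimes>\<^bsub>add_monoid R\<^esub> v \<in> x <# carrier R" by (auto simp: l_coset_def)
  qed (use assms in \<open>auto simp: l_coset_def\<close>)
  fix u s assume "u \<in> x <# carrier R" "s \<in> carrier R"
  then show "u \<otimes> s \<in> x <# carrier R" using assms by (auto simp: l_coset_def m_assoc)
qed

lemma right_ideal_eq_carrier:
  assumes "right_ideal R I" "\<one> \<in> I" shows "I = carrier R"
proof
  show "I \<subseteq> carrier R" using assms(1) additive_subgroup.a_subset by (auto simp: right_ideal_def)
  show "carrier R \<subseteq> I"
  proof
    fix x assume "x \<in> carrier R"
    then have "\<one> \<otimes> x \<in> I" using assms unfolding right_ideal_def by blast
    with \<open>x \<in> carrier R\<close> show "x \<in> I" by simp
  qed
qed

text \<open>The union of a chain of right ideals avoiding 1 avoids 1, so Zorn's lemma applies.\<close>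

lemma exists_maximal_right_ideal:
  assumes I: "right_ideal R I" "\<one> \<notin> I"
  obtains M where "maximal_right_ideal R M" "I \<subseteq> M"
proof -
  define \<A> where "\<A> = {K. right_ideal R K \<and> I \<subseteq> K \<and> \<one> \<notin> K}"
  have "\<exists>M\<in>\<A>. \<forall>K\<in>\<A>. M \<subseteq> K \<longrightarrow> K = M"
  proof (rule subset_Zorn_nonempty)
    show "\<A> \<noteq> {}" using I by (auto simp: \<A>_def)
    fix C assume C: "C \<noteq> {}" "subset.chain \<A> C"
    then have sub: "C \<subseteq> \<A>" and chain: "\<And>K L. K \<in> C \<Longrightarrow> L \<in> C \<Longrightarrow> K \<subseteq> L \<or> L \<subseteq> K"
      by (auto simp: subset_chain_def)
    have grp: "additive_subgroup K R" if "K \<in> C" for K using sub that by (auto simp: right_ideal_def \<A>_def)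
    have "additive_subgroup (\<Union>C) R"
    proof (intro additive_subgroup.intro, rule group.subgroupI)
      show "Group.group (add_monoid R)" by (rule a_group)
      show "\<Union>C \<subseteq> carrier (add_monoid R)" using additive_subgroup.a_subset[OF grp] by auto
      show "\<Union>C \<noteq> {}" using C(1) additive_subgroup.zero_closed[OF grp] by blast
      fix u assume "u \<in> \<Union>C"
      then obtain K where K: "K \<in> C" "u \<in> K" by blast
      then show "inv\<^bsub>add_monoid R\<^esub> u \<in> \<Union>C"
        using additive_subgroup.a_inv_closed[OF grp] by (auto simp: a_inv_def)
      fix v assume "v \<in> \<Union>C"
      then obtain L where L: "L \<in> C" "v \<in> L" by blast
      from chain[OF K(1) L(1)] have "\<exists>N\<in>C. u \<in> N \<and> v \<in> N" using K L by blast
      then show "u \<otimes>\<^bsub>add_monoid R\<^esub> v \<in> \<Union>C"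
        using additive_subgroup.a_closed[OF grp] by auto
    qed
    with sub C(1) show "\<Union>C \<in> \<A>" unfolding right_ideal_def \<A>_def by blast
  qed
  then obtain M where MA: "M \<in> \<A>" and max: "\<forall>K\<in>\<A>. M \<subseteq> K \<longrightarrow> K = M" by (elim bexE)
  then have M: "right_ideal R M" "I \<subseteq> M" "\<one> \<notin> M" by (simp_all add: \<A>_def)
  have "K = M \<or> K = carrier R" if K: "right_ideal R K" "M \<subseteq> K" for K
  proof (cases "\<one> \<in> K")
    case True
    then show ?thesis using right_ideal_eq_carrier K(1) by simp
  next
    case False
    then have "K \<in> \<A>" using K M(2) by (auto simp: \<A>_def)
    then show ?thesis using max K(2) by simp
  qed
  with M(1,3) have "maximal_right_ideal R M" unfolding maximal_right_ideal_def by auto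
  with M(2) that show ?thesis by blast
qed

text \<open>
  If \<open>1 - xr\<close> is not right invertible, it lies in a maximal right ideal, which cannot also contain
  \<open>xr\<close>, so \<open>x\<close> is not in the radical. If \<open>x\<close> is outside a maximal right ideal \<open>M\<close>, then \<open>M + xR\<close> contains 1, so some
  \<open>1 - xr\<close> lies in \<open>M\<close> and is not right invertible.
\<close>

lemma jacobson_radical_iff:
  "x \<in> jacobson_radical R \<longleftrightarrow> x \<in> carrier R \<and> (\<forall>r\<in>carrier R. right_invertible_in R (\<one> \<ominus> x \<otimes> r))"
proof (intro iffI conjI ballI)
  assume x: "x \<in> jacobson_radical R"
  then show xc: "x \<in> carrier R" by (simp add: jacobson_radical_def)
  fix r assume r: "r \<in> carrier R"
  show "right_invertible_in R (\<one> \<ominus> x \<otimes> r)"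
  proof (rule ccontr)
    assume ninv: "\<not> right_invertible_in R (\<one> \<ominus> x \<otimes> r)"
    let ?I = "(\<one> \<ominus> x \<otimes> r) <# carrier R"
    have "\<one> \<notin> ?I" using ninv by (auto simp: l_coset_def right_invertible_in_def)
    with right_ideal_principal[of "\<one> \<ominus> x \<otimes> r"] xc r obtain M
      where M: "maximal_right_ideal R M" "?I \<subseteq> M" by (auto intro: exists_maximal_right_ideal)
    then have rM: "right_ideal R M" by (simp add: maximal_right_ideal_def)
    have "(\<one> \<ominus> x \<otimes> r) \<otimes> \<one> \<in> ?I" unfolding l_coset_def by blast
    then have 1: "\<one> \<ominus> x \<otimes> r \<in> M" using M(2) xc r by auto
    have 2: "x \<otimes> r \<in> M" using x M(1) rM r by (auto simp: jacobson_radical_def right_ideal_def)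
    have "(\<one> \<ominus> x \<otimes> r) \<oplus> x \<otimes> r \<in> M"
      using 1 2 rM additive_subgroup.a_closed by (auto simp: right_ideal_def)
    moreover have "(\<one> \<ominus> x \<otimes> r) \<oplus> x \<otimes> r = \<one>" using xc r by algebra
    ultimately have "M = carrier R" using right_ideal_eq_carrier rM by simp
    with M(1) show False by (simp add: maximal_right_ideal_def)
  qed
next
  assume x: "x \<in> carrier R \<and> (\<forall>r\<in>carrier R. right_invertible_in R (\<one> \<ominus> x \<otimes> r))"
  have "x \<in> M" if M: "maximal_right_ideal R M" for M
  proof (rule ccontr)
    assume nx: "x \<notin> M"
    have rM: "right_ideal R M" and aM: "additive_subgroup M R"
      using M by (simp_all add: maximal_right_ideal_def right_ideal_def)
    have rx: "right_ideal R (x <# carrier R)" using right_ideal_principal x by blast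
    let ?S = "set_add R M (x <# carrier R)"
    have S: "right_ideal R ?S" unfolding right_ideal_def
    proof (intro conjI ballI)
      show "additive_subgroup ?S R"
        using aM rx add_additive_subgroups unfolding right_ideal_def by blast
      fix u r assume "u \<in> ?S" and r: "r \<in> carrier R"
      then obtain m k where mk: "m \<in> M" "k \<in> x <# carrier R" "u = m \<oplus> k"
        by (auto simp: set_add_def set_mult_def)
      then have "m \<in> carrier R" "k \<in> carrier R"
        using aM rx additive_subgroup.a_subset unfolding right_ideal_def by blast+
      then have "u \<otimes> r = m \<otimes> r \<oplus> k \<otimes> r" using mk(3) r by (simp add: l_distr)
      moreover have "m \<otimes> r \<in> M" "k \<otimes> r \<in> x <# carrier R"
        using mk r rM rx unfolding right_ideal_def by blast+
      ultimately show "u \<otimes> r \<in> ?S" by (auto simp: set_add_def set_mult_def)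
    qed
    have x1: "x \<in> x <# carrier R" using x unfolding l_coset_def by (auto intro!: bexI[of _ \<one>])
    have "M \<subseteq> ?S"
    proof
      fix m assume "m \<in> M"
      then have "m = m \<oplus> \<zero>" using aM additive_subgroup.a_Hcarr by fastforce
      moreover have "\<zero> \<in> x <# carrier R"
        using rx additive_subgroup.zero_closed unfolding right_ideal_def by blast
      ultimately show "m \<in> ?S" using \<open>m \<in> M\<close> unfolding set_add_def set_mult_def by fastforce
    qed
    moreover have "x \<in> ?S"
    proof -
      have "x = \<zero> \<oplus> x" "\<zero> \<in> M" using x additive_subgroup.zero_closed[OF aM] by auto
      then show ?thesis using x1 unfolding set_add_def set_mult_def by fastforce
    qed
    ultimately have "?S = carrier R" using M S nx unfolding maximal_right_ideal_def by blast
    then have "\<one> \<in> ?S" by simp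
    then obtain m r where m: "m \<in> M" "r \<in> carrier R" "\<one> = m \<oplus> x \<otimes> r"
      by (auto simp: set_add_def set_mult_def l_coset_def)
    have mc: "m \<in> carrier R" using m(1) aM additive_subgroup.a_Hcarr by fastforce
    have "\<one> \<ominus> x \<otimes> r = m" unfolding m(3) using mc m(2) x by algebra
    then obtain y where "y \<in> carrier R" "m \<otimes> y = \<one>" using x m(2) by (auto simp: right_invertible_in_def)
    then have "\<one> \<in> M" using rM m(1) unfolding right_ideal_def by force
    with right_ideal_eq_carrier rM M show False by (simp add: maximal_right_ideal_def)
  qed
  with x show "x \<in> jacobson_radical R" by (simp add: jacobson_radical_def)
qed

text \<open>
  If \<open>t\<close> is a right inverse of \<open>1 - xy\<close>, then \<open>1 + ytx\<close> is one of \<open>1 - yx\<close>. This makes the radical,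
  defined by right ideals, a left ideal as well.
\<close>

lemma right_invertible_swap:
  assumes "x \<in> carrier R" "y \<in> carrier R" "right_invertible_in R (\<one> \<ominus> x \<otimes> y)"
  shows "right_invertible_in R (\<one> \<ominus> y \<otimes> x)"
proof -
  obtain t where t: "t \<in> carrier R" "(\<one> \<ominus> x \<otimes> y) \<otimes> t = \<one>"
    using assms(3) by (auto simp: right_invertible_in_def)
  have "(\<one> \<ominus> y \<otimes> x) \<otimes> (\<one> \<oplus> y \<otimes> (t \<otimes> x)) = \<one> \<oplus> y \<otimes> ((\<one> \<ominus> x \<otimes> y) \<otimes> t) \<otimes> x \<ominus> y \<otimes> x"
    using assms(1,2) t(1) by (simp add: ring_simprules)
  also have "\<dots> = \<one>" unfolding t(2) using assms(1,2) by (simp add: ring_simprules)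
  finally show ?thesis using assms t(1) unfolding right_invertible_in_def by blast
qed

lemma right_invertible_mult:
  assumes "x \<in> carrier R" "y \<in> carrier R" "right_invertible_in R x" "right_invertible_in R y"
  shows "right_invertible_in R (x \<otimes> y)"
proof -
  obtain s t where st: "s \<in> carrier R" "t \<in> carrier R" "x \<otimes> s = \<one>" "y \<otimes> t = \<one>"
    using assms by (auto simp: right_invertible_in_def)
  have "x \<otimes> y \<otimes> (t \<otimes> s) = x \<otimes> (y \<otimes> t) \<otimes> s" using assms(1,2) st(1,2) by (simp add: m_assoc)
  with st assms show ?thesis unfolding right_invertible_in_def by (intro bexI[of _ "t \<otimes> s"]) auto
qed

lemma ideal_jacobson_radical: "ideal (jacobson_radical R) R"
proof (rule idealI)
  show "ring R" by (rule ring_axioms)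
  show "subgroup (jacobson_radical R) (add_monoid R)"
  proof (rule group.subgroupI)
    show "Group.group (add_monoid R)" by (rule a_group)
    show "jacobson_radical R \<subseteq> carrier (add_monoid R)" by (auto simp: jacobson_radical_def)
    have "\<zero> \<in> jacobson_radical R" by (auto simp: jacobson_radical_iff right_invertible_in_def minus_eq)
    then show "jacobson_radical R \<noteq> {}" by blast
    fix x assume x: "x \<in> jacobson_radical R"
    have "right_invertible_in R (\<one> \<ominus> (\<ominus> x) \<otimes> r)" if "r \<in> carrier R" for r
    proof -
      have "(\<ominus> x) \<otimes> r = x \<otimes> (\<ominus> r)" using x that by (simp add: jacobson_radical_iff l_minus r_minus)
      then show ?thesis using x that by (simp add: jacobson_radical_iff)
    qed
    then show "inv\<^bsub>add_monoid R\<^esub> x \<in> jacobson_radical R"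
      using x by (simp add: jacobson_radical_iff flip: a_inv_def)
    fix y assume y: "y \<in> jacobson_radical R"
    have "x \<oplus> y \<in> M" if M: "maximal_right_ideal R M" for M
    proof (rule additive_subgroup.a_closed)
      show "additive_subgroup M R" using M by (simp add: maximal_right_ideal_def right_ideal_def)
      show "x \<in> M" "y \<in> M" using x y M by (simp_all add: jacobson_radical_def)
    qed
    then show "x \<otimes>\<^bsub>add_monoid R\<^esub> y \<in> jacobson_radical R" using x y by (simp add: jacobson_radical_def)
  qed
  fix x r assume x: "x \<in> jacobson_radical R" and r: "r \<in> carrier R"
  then have xc: "x \<in> carrier R" by (simp add: jacobson_radical_def)
  show "x \<otimes> r \<in> jacobson_radical R" unfolding jacobson_radical_iff
  proof (intro conjI ballI)
    fix s assume s: "s \<in> carrier R"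
    then have "right_invertible_in R (\<one> \<ominus> x \<otimes> (r \<otimes> s))" using x r jacobson_radical_iff by blast
    then show "right_invertible_in R (\<one> \<ominus> x \<otimes> r \<otimes> s)" using xc r s by (simp add: m_assoc)
  qed (use xc r in simp)
  have "right_invertible_in R (\<one> \<ominus> r \<otimes> x \<otimes> s)" if s: "s \<in> carrier R" for s
  proof -
    have "right_invertible_in R (\<one> \<ominus> x \<otimes> (s \<otimes> r))" using x r s jacobson_radical_iff by blast
    then have "right_invertible_in R (\<one> \<ominus> x \<otimes> s \<otimes> r)" using xc r s by (simp add: m_assoc)
    then show ?thesis using right_invertible_swap[of "x \<otimes> s" r] r s xc by (simp add: m_assoc)
  qed
  then show "r \<otimes> x \<in> jacobson_radical R" using xc r by (simp add: jacobson_radical_iff[of "r \<otimes> x"])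
qed

end

section \<open>Idempotents in right ideals\<close>

text \<open>
  Principal right ideals suffice, since every nonzero right ideal contains a nonzero one of them.
  In Nicholson's terminology the rings in question are the I0-rings with zero Jacobson radical.
\<close>

definition idempotent_rich :: "('a, 'm) ring_scheme \<Rightarrow> bool" where
  "idempotent_rich R \<longleftrightarrow> (\<forall>y\<in>carrier R. y \<noteq> \<zero>\<^bsub>R\<^esub> \<longrightarrow>
     (\<exists>r\<in>carrier R. idempotent_in R (y \<otimes>\<^bsub>R\<^esub> r) \<and> y \<otimes>\<^bsub>R\<^esub> r \<noteq> \<zero>\<^bsub>R\<^esub>))"

definition reduced_ring :: "('a, 'm) ring_scheme \<Rightarrow> bool" where
  "reduced_ring R \<longleftrightarrow> (\<forall>w\<in>carrier R. w \<otimes>\<^bsub>R\<^esub> w = \<zero>\<^bsub>R\<^esub> \<longrightarrow> w = \<zero>\<^bsub>R\<^esub>)"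

context ring begin

text \<open>The right inverse is a partial sum of the geometric series.\<close>

lemma right_invertible_one_minus_nilpotent:
  assumes "nilpotent_in R t" shows "right_invertible_in R (\<one> \<ominus> t)"
proof -
  obtain n :: nat where t: "t \<in> carrier R" "t [^] n = \<zero>" using assms by (auto simp: nilpotent_in_def)
  have "\<exists>s\<in>carrier R. (\<one> \<ominus> t) \<otimes> s = \<one> \<ominus> t [^] k" for k :: nat
  proof (induction k)
    case 0
    then show ?case using t(1) by (intro bexI[of _ \<zero>]) (auto simp: minus_eq r_neg)
  next
    case (Suc k)
    then obtain s where s: "s \<in> carrier R" "(\<one> \<ominus> t) \<otimes> s = \<one> \<ominus> t [^] k" by blast
    define p where "p = t [^] k"
    have p: "p \<in> carrier R" "t [^] Suc k = t \<otimes> p" using t(1) unfolding p_def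
      by (simp, metis nat_pow_Suc2)
    have "(\<one> \<ominus> t) \<otimes> (s \<oplus> p) = (\<one> \<ominus> t) \<otimes> s \<oplus> (p \<ominus> t \<otimes> p)"
      using t(1) p(1) s(1) by algebra
    also have "\<dots> = \<one> \<ominus> t \<otimes> p" unfolding s(2) p_def[symmetric] using t(1) p(1) by algebra
    finally show ?case using s(1) p by (intro bexI[of _ "s \<oplus> p"]) auto
  qed
  from this[of n] t show ?thesis by (auto simp: right_invertible_in_def minus_eq)
qed

lemma nilpotent_zero_if_reduced:
  assumes "reduced_ring R" "nilpotent_in R x" shows "x = \<zero>"
proof -
  obtain n :: nat where x: "x \<in> carrier R" "x [^] n = \<zero>" using assms by (auto simp: nilpotent_in_def)
  (* Exponents are taken to be powers of two so that the squaring step is the hypothesis itself. *)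
  have "y = \<zero>" if "y \<in> carrier R" "y [^] ((2::nat) ^ k) = \<zero>" for y k
    using that
  proof (induction k arbitrary: y)
    case (Suc k)
    have "(y \<otimes> y) [^] ((2::nat) ^ k) = y [^] ((2::nat) ^ Suc k)"
      using Suc.prems(1) pow_mult_distrib[of y y "2 ^ k"] by (simp add: nat_pow_mult mult_2)
    with Suc.IH[of "y \<otimes> y"] Suc.prems have "y \<otimes> y = \<zero>" by simp
    with assms(1) Suc.prems(1) show ?case unfolding reduced_ring_def by blast
  qed simp
  moreover have "x [^] (n + (2 ^ n - n)) = \<zero>"
    using x by (subst nat_pow_mult[symmetric]) auto
  then have "x [^] ((2::nat) ^ n) = \<zero>" by simp
  ultimately show ?thesis using x(1) by blast
qed

text \<open>
  If \<open>(1 - x)y = 1\<close>, then \<open>1 - y(1 - x)\<close> is an idempotent annihilated by \<open>1 - x\<close> from the left, hence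
  contained in \<open>xR\<close>; when it vanishes, \<open>y\<close> is a two-sided inverse.
\<close>

lemma right_invertible_one_minus_without_idempotents:
  assumes x: "x \<in> carrier R" and inv: "right_invertible_in R (\<one> \<ominus> x)"
    and no_idem: "\<And>r. r \<in> carrier R \<Longrightarrow> idempotent_in R (x \<otimes> r) \<Longrightarrow> x \<otimes> r = \<zero>"
  shows "\<one> \<ominus> x \<in> Units R"
proof -
  obtain y where y: "y \<in> carrier R" "(\<one> \<ominus> x) \<otimes> y = \<one>" using inv by (auto simp: right_invertible_in_def)
  define p where "p = y \<otimes> (\<one> \<ominus> x)"
  have p: "p \<in> carrier R" using x y by (simp add: p_def)
  have "p \<otimes> p = y \<otimes> ((\<one> \<ominus> x) \<otimes> y) \<otimes> (\<one> \<ominus> x)"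
    unfolding p_def using x y(1) by (simp add: m_assoc)
  then have pp: "p \<otimes> p = p" using y x by (simp add: p_def)
  have "(\<one> \<ominus> x) \<otimes> p = ((\<one> \<ominus> x) \<otimes> y) \<otimes> (\<one> \<ominus> x)" unfolding p_def using x y(1) by (simp add: m_assoc)
  then have xp: "(\<one> \<ominus> x) \<otimes> p = \<one> \<ominus> x" using y x by simp
  have "x \<otimes> (\<one> \<ominus> p) = (\<one> \<ominus> p) \<oplus> ((\<one> \<ominus> x) \<otimes> p \<ominus> (\<one> \<ominus> x))" using x p by (simp add: minus_eq l_distr r_distr, algebra)
  also have "\<dots> = \<one> \<ominus> p" unfolding xp using x p by algebra
  finally have g: "x \<otimes> (\<one> \<ominus> p) = \<one> \<ominus> p" .
  have "(\<one> \<ominus> p) \<otimes> (\<one> \<ominus> p) = \<one> \<ominus> p \<oplus> (p \<otimes> p \<ominus> p)" using p by (simp add: ring_simprules)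
  then have "(\<one> \<ominus> p) \<otimes> (\<one> \<ominus> p) = \<one> \<ominus> p" unfolding pp using p by algebra
  then have "\<one> \<ominus> p = \<zero>" using no_idem[of "\<one> \<ominus> p"] g p by (simp add: idempotent_in_def)
  then have "p = \<one>" using p by (metis one_closed r_right_minus_eq)
  then show ?thesis using x y by (auto simp: Units_def p_def)
qed

text \<open>
  Let \<open>I\<close> be a right ideal whose only idempotent is zero. For \<open>x \<in> I\<close> the weak exchange property makes
  \<open>1 - x\<close> or \<open>1 + x\<close> right invertible, hence a unit, hence of square 1; so \<open>x\<^sup>2 = 2x\<close> or \<open>x\<^sup>2 = -2x\<close>.
  Comparing this for \<open>x\<close> and for \<open>2x\<close> gives \<open>12x = 0\<close>. Hence \<open>t = 3x\<close> satisfies \<open>4t = 0\<close> and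
  \<open>t\<^sup>2 = \<plusminus>2t\<close>, so \<open>t\<^sup>4 = 4t\<^sup>2 = 0\<close>. As this holds
  throughout \<open>I\<close>, every \<open>3x\<close> lies in the radical and is zero. But then \<open>x\<^sup>2 = x\<close> or \<open>x\<^sup>2 = -x\<close>, so \<open>x\<close> or
  \<open>-x\<close> is an idempotent of \<open>I\<close>, and \<open>x = 0\<close>.
\<close>

lemma idempotent_rich_if_weakly_exchange:
  assumes J: "jacobson_radical R = {\<zero>}" and we: "weakly_exchange R"
    and units: "\<And>u. u \<in> Units R \<Longrightarrow> u \<otimes> u = \<one>"
  shows "idempotent_rich R"
  unfolding idempotent_rich_def
proof (intro ballI impI, rule ccontr)
  fix y assume y: "y \<in> carrier R" "y \<noteq> \<zero>"
    and neg: "\<not> (\<exists>r\<in>carrier R. idempotent_in R (y \<otimes> r) \<and> y \<otimes> r \<noteq> \<zero>)"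
  define I where "I = y <# carrier R"
  have I: "right_ideal R I" unfolding I_def by (rule right_ideal_principal[OF y(1)])
  interpret I: additive_subgroup I R using I by (simp add: right_ideal_def)
  have Ic: "x \<in> carrier R" if "x \<in> I" for x using that by (rule I.a_Hcarr)
  have Imult: "x \<otimes> r \<in> I" if "x \<in> I" "r \<in> carrier R" for x r
    using I that unfolding right_ideal_def by blast
  have Izero: "x = \<zero>" if "x \<in> I" "x \<otimes> x = x" for x
    using neg that Ic[OF that(1)] unfolding I_def l_coset_def idempotent_in_def by blast
  have square: "x \<otimes> x = x \<oplus> x" if x: "x \<in> I" and inv: "right_invertible_in R (\<one> \<ominus> x)" for x
  proof -
    have "\<one> \<ominus> x \<in> Units R"
      by (rule right_invertible_one_minus_without_idempotents[OF Ic[OF x] inv])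
         (use Izero Imult x in \<open>auto simp: idempotent_in_def\<close>)
    then have "(\<one> \<ominus> x) \<otimes> (\<one> \<ominus> x) = \<one>" by (rule units)
    moreover have "x \<otimes> x = (\<one> \<ominus> x) \<otimes> (\<one> \<ominus> x) \<ominus> \<one> \<oplus> (x \<oplus> x)"
      using Ic[OF x] by (simp add: minus_eq l_distr r_distr, algebra)
    ultimately show ?thesis using Ic[OF x] by (simp add: minus_eq r_neg)
  qed
  have squares: "x \<otimes> x = x \<oplus> x \<or> x \<otimes> x = \<ominus> (x \<oplus> x)" if x: "x \<in> I" for x
  proof -
    note xc = Ic[OF x]
    obtain e where e: "idempotent_in R e" "e \<in> x <# carrier R"
      "\<one> \<ominus> e \<in> ((\<one> \<ominus> x) <# carrier R) \<union> ((\<one> \<oplus> x) <# carrier R)"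
      using we xc unfolding weakly_exchange_def by blast
    have "e = \<zero>" using e(1,2) Izero Imult x by (auto simp: l_coset_def idempotent_in_def)
    then have "\<one> \<in> ((\<one> \<ominus> x) <# carrier R) \<union> ((\<one> \<oplus> x) <# carrier R)"
      using e(3) by (simp add: minus_eq)
    then have "right_invertible_in R (\<one> \<ominus> x) \<or> right_invertible_in R (\<one> \<oplus> x)"
      unfolding l_coset_def right_invertible_in_def by fastforce
    moreover have "x \<otimes> x = \<ominus> (x \<oplus> x)" if "right_invertible_in R (\<one> \<oplus> x)"
    proof -
      have "(\<ominus> x) \<otimes> (\<ominus> x) = (\<ominus> x) \<oplus> (\<ominus> x)"
        by (rule square) (use x xc that in \<open>auto simp: minus_eq\<close>)
      then show ?thesis using xc by (simp add: l_minus r_minus minus_add)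
    qed
    ultimately show ?thesis using square x by blast
  qed
  have three: "nilpotent_in R (x \<oplus> x \<oplus> x)" if x: "x \<in> I" for x
  proof -
    note xc = Ic[OF x]
    define s where "s = x \<oplus> x"
    define t where "t = x \<oplus> x \<oplus> x"
    have st: "s \<in> I" "t \<in> I" "s \<in> carrier R" "t \<in> carrier R" using x xc by (auto simp: s_def t_def)
    have ss: "s \<otimes> s = x \<otimes> x \<oplus> x \<otimes> x \<oplus> (x \<otimes> x \<oplus> x \<otimes> x)"
      unfolding s_def using xc by algebra
    have sx: "s \<otimes> s = s \<oplus> s \<oplus> (s \<oplus> s) \<or> s \<otimes> s = \<ominus> (s \<oplus> s \<oplus> (s \<oplus> s))"
      using squares[OF x]
    proof
      assume "x \<otimes> x = x \<oplus> x"
      then show ?thesis unfolding ss s_def[symmetric] by (simp add: s_def)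
    next
      assume "x \<otimes> x = \<ominus> (x \<oplus> x)"
      then show ?thesis unfolding ss s_def[symmetric] using st(3) by (simp add: minus_add a_ac)
    qed
    define q where "q = s \<oplus> s"
    have q: "q \<in> carrier R" using st by (simp add: q_def)
    have sx': "s \<otimes> s = q \<oplus> q \<or> s \<otimes> s = \<ominus> (q \<oplus> q)" using sx by (simp add: q_def)
    have sq: "s \<otimes> s = q \<or> s \<otimes> s = \<ominus> q" using squares[OF st(1)] by (simp add: q_def)
    have "q \<oplus> q \<oplus> q = \<zero>"
    proof -
      have neg: "x = \<ominus> z" if "\<ominus> x = z" "x \<in> carrier R" for x z
        using minus_minus[OF that(2)] that(1) by simp
      from sx' sq consider "q \<oplus> q = q" | "q \<oplus> q = \<ominus> q" | "\<ominus> (q \<oplus> q) = q" | "\<ominus> (q \<oplus> q) = \<ominus> q" by auto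
      then have "q \<oplus> q = q \<or> q \<oplus> q = \<ominus> q"
      proof cases
        case 3
        with neg[of "q \<oplus> q" q] q show ?thesis by simp
      next
        case 4
        with neg[of "q \<oplus> q" "\<ominus> q"] q show ?thesis by simp
      qed simp_all
      then show ?thesis
      proof
        assume "q \<oplus> q = q"
        with q show ?thesis by simp
      next
        assume "q \<oplus> q = \<ominus> q"
        with q show ?thesis by (simp add: l_neg)
      qed
    qed
    moreover have "t \<oplus> t \<oplus> (t \<oplus> t) = q \<oplus> q \<oplus> q"
      unfolding t_def q_def s_def using xc by (simp add: a_ac)
    ultimately have t4: "t \<oplus> t \<oplus> (t \<oplus> t) = \<zero>" by simp
    have "(t \<otimes> t) \<otimes> (t \<otimes> t) = (t \<oplus> t) \<otimes> (t \<oplus> t)"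
      using squares[OF st(2)] st(4) by (auto simp: l_minus r_minus)
    also have "\<dots> = (t \<oplus> t \<oplus> (t \<oplus> t)) \<otimes> t" using st(4) by algebra
    finally have "(t \<otimes> t) \<otimes> (t \<otimes> t) = \<zero>" using t4 st(4) by simp
    then have "(t \<otimes> t) [^] (2::nat) = \<zero>" using st(4) by (simp add: numeral_2_eq_2)
    then have "nilpotent_in R (t \<otimes> t)" using st(4) unfolding nilpotent_in_def by blast
    then show ?thesis using nilpotent_square st(4) unfolding t_def by blast
  qed
  have yI: "y \<in> I" using y(1) unfolding I_def l_coset_def by (auto intro!: bexI[of _ \<one>])
  have "y \<oplus> y \<oplus> y \<in> jacobson_radical R" unfolding jacobson_radical_iff
  proof (intro conjI ballI)
    fix r assume r: "r \<in> carrier R"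
    have "(y \<oplus> y \<oplus> y) \<otimes> r = y \<otimes> r \<oplus> y \<otimes> r \<oplus> y \<otimes> r" using y(1) r by (simp add: l_distr)
    with three[OF Imult[OF yI r]] show "right_invertible_in R (\<one> \<ominus> (y \<oplus> y \<oplus> y) \<otimes> r)"
      by (simp add: right_invertible_one_minus_nilpotent)
  qed (use y(1) in simp)
  then have y3: "y \<oplus> y \<oplus> y = \<zero>" using J by blast
  have y2: "y \<oplus> y = \<ominus> y" using y3 y(1) by (simp add: minus_equality minus_minus)
  from squares[OF yI] have "y \<otimes> y = \<ominus> y \<or> y \<otimes> y = y" unfolding y2 using y(1) by simp
  then have "y \<otimes> y = y \<or> (\<ominus> y) \<otimes> (\<ominus> y) = \<ominus> y" using y(1) by (auto simp: l_minus r_minus)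
  then have "y = \<zero> \<or> \<ominus> y = \<zero>" using Izero yI I.a_inv_closed by blast
  then have "y = \<zero>" using y(1) by (metis minus_minus minus_zero)
  with y(2) show False by simp
qed

text \<open>
  If \<open>yR\<close> contains no nonzero idempotent, the lift of the square of any \<open>yr\<close> vanishes. So \<open>yr\<close> is
  nilpotent, \<open>1 - yr\<close> is right invertible, and \<open>y\<close> lies in the radical.
\<close>

lemma idempotent_rich_if_nil_tripotent:
  assumes J: "jacobson_radical R = {\<zero>}" and nt: "nil_tripotent R"
  shows "idempotent_rich R"
  unfolding idempotent_rich_def
proof (intro ballI impI, rule ccontr)
  fix y assume y: "y \<in> carrier R" "y \<noteq> \<zero>"
    and neg: "\<not> (\<exists>r\<in>carrier R. idempotent_in R (y \<otimes> r) \<and> y \<otimes> r \<noteq> \<zero>)"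
  have "right_invertible_in R (\<one> \<ominus> y \<otimes> r)" if r: "r \<in> carrier R" for r
  proof -
    have yr: "y \<otimes> r \<in> carrier R" using y r by simp
    obtain e s s' w where e: "idempotent_in R e" "s \<in> carrier R" "s' \<in> carrier R" "nilpotent_in R w"
      "e = y \<otimes> r \<otimes> s" "\<one> \<ominus> e = (\<one> \<ominus> y \<otimes> r) \<otimes> s'" "e \<oplus> w = y \<otimes> r \<otimes> (y \<otimes> r)"
      by (rule nil_tripotent_square_lift[OF nt yr])
    have "e = y \<otimes> (r \<otimes> s)" using e(2,5) y r by (simp add: m_assoc)
    then have "e = \<zero>" using neg e(1) r e(2) by (metis m_closed)
    moreover have "w \<in> carrier R" using e(4) by (simp add: nilpotent_in_def)
    ultimately have "nilpotent_in R (y \<otimes> r \<otimes> (y \<otimes> r))" using e(4,7) by simp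
    then show ?thesis using nilpotent_square[OF yr] right_invertible_one_minus_nilpotent by blast
  qed
  then have "y \<in> jacobson_radical R" using y(1) by (simp add: jacobson_radical_iff)
  with J y(2) show False by simp
qed

subsection \<open>Reducedness and tripotence\<close>

text \<open>
  The hypotheses say that \<open>x = y + g\<close> satisfies \<open>x\<^sup>2 = x + g\<close> in the corner ring \<open>gRg\<close>, like the
  Fibonacci matrix with rows \<open>(1, 1)\<close> and \<open>(1, 0)\<close>; there \<open>x\<close> is invertible with inverse \<open>y = x - g\<close>. The
  element \<open>u = x + (1 - g)\<close> is a unit of \<open>R\<close> with \<open>u\<^sup>2 - 1 = x\<close>, so \<open>x\<close> is nilpotent as well as invertible
  in the corner.
\<close>

lemma fibonacci_corner_trivial:
  assumes units: "\<And>u. u \<in> Units R \<Longrightarrow> nilpotent_in R (u \<otimes> u \<ominus> \<one>)"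
    and c: "y \<in> carrier R" "g \<in> carrier R"
    and yy: "y \<otimes> y = g \<ominus> y" and gy: "g \<otimes> y = y" and yg: "y \<otimes> g = y" and gg: "g \<otimes> g = g"
  shows "g = \<zero>"
proof -
  (* v is y, the inverse of x in the corner, plus 1 - g. *)
  define u v where "u = \<one> \<oplus> y" and "v = \<one> \<oplus> y \<ominus> g"
  have uv: "u \<in> carrier R" "v \<in> carrier R" using c by (simp_all add: u_def v_def)
  have "u \<otimes> v = \<one> \<oplus> y \<ominus> g \<oplus> (y \<oplus> y \<otimes> y \<ominus> y \<otimes> g)"
    unfolding u_def v_def using c by (simp add: ring_simprules)
  also have "\<dots> = \<one>" unfolding yy yg using c by algebra
  finally have 1: "u \<otimes> v = \<one>" .
  have "v \<otimes> u = \<one> \<oplus> y \<ominus> g \<oplus> (y \<oplus> y \<otimes> y \<ominus> g \<otimes> y)"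
    unfolding u_def v_def using c by (simp add: ring_simprules)
  also have "\<dots> = \<one>" unfolding yy gy using c by algebra
  finally have "u \<in> Units R" using 1 uv by (auto simp: Units_def)
  from units[OF this] have "nilpotent_in R (u \<otimes> u \<ominus> \<one>)" .
  also have "u \<otimes> u \<ominus> \<one> = y \<oplus> (y \<oplus> y \<otimes> y)" unfolding u_def using c by (simp add: minus_eq l_distr r_distr, algebra)
  also have "\<dots> = y \<oplus> g" unfolding yy using c by algebra
  finally have "nilpotent_in R (y \<oplus> g)" .
  then obtain n :: nat where n: "(y \<oplus> g) [^] n = \<zero>" by (auto simp: nilpotent_in_def)
  have "(y \<oplus> g) \<otimes> y = y \<otimes> y \<oplus> y" using c gy by (simp add: l_distr)
  also have "\<dots> = g" unfolding yy using c by algebra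
  finally have x1: "(y \<oplus> g) \<otimes> y = g" .
  have "y \<otimes> (y \<oplus> g) = y \<otimes> y \<oplus> y" using c yg by (simp add: r_distr)
  also have "\<dots> = g" unfolding yy using c by algebra
  finally have x2: "y \<otimes> (y \<oplus> g) = g" .
  have "((y \<oplus> g) \<otimes> y) [^] n = (y \<oplus> g) [^] n \<otimes> y [^] n"
    by (rule pow_mult_distrib) (use x1 x2 c in auto)
  then have "g [^] n = \<zero>" using n x1 c by simp
  then have "nilpotent_in R g" using c by (auto simp: nilpotent_in_def)
  then show ?thesis using nilpotent_idempotent_zero gg by blast
qed

text \<open>
  Let \<open>w\<^sup>2 = 0\<close> and let \<open>e = wr\<close> be a nonzero idempotent with \<open>re = r\<close>. Then \<open>a = ew\<close>, \<open>b = (1 - e)r\<close>, \<open>e\<close>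
  and \<open>f = ba\<close> multiply like the matrix units with indices 12, 21, 11 and 22. The Fibonacci matrix
  is \<open>e + a + b\<close>, and its inverse in the corner of \<open>g = e + f\<close> is \<open>y = a + b - f\<close>.
\<close>

lemma reduced_if_idempotent_rich:
  assumes rich: "idempotent_rich R"
    and units: "\<And>u. u \<in> Units R \<Longrightarrow> nilpotent_in R (u \<otimes> u \<ominus> \<one>)"
  shows "reduced_ring R"
  unfolding reduced_ring_def
proof (intro ballI impI, rule ccontr)
  fix w assume w: "w \<in> carrier R" "w \<otimes> w = \<zero>" "w \<noteq> \<zero>"
  then obtain r0 where r0: "r0 \<in> carrier R" "idempotent_in R (w \<otimes> r0)" "w \<otimes> r0 \<noteq> \<zero>"
    using rich unfolding idempotent_rich_def by blast
  define e where "e = w \<otimes> r0"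
  (* Replacing r0 by r0 e keeps w r0 = e and ensures that r e = r. *)
  define r where "r = r0 \<otimes> e"
  have ee: "e \<otimes> e = e" and ec: "e \<in> carrier R" using r0(2) by (simp_all add: e_def idempotent_in_def)
  have r: "r \<in> carrier R" "r \<otimes> e = r" using r0(1) ec ee by (simp_all add: r_def m_assoc)
  have wr: "w \<otimes> r = e" using w(1) r0(1) ee ec unfolding r_def by (metis e_def m_assoc)
  have we: "w \<otimes> e = \<zero>" unfolding wr[symmetric] using w(1,2) r(1) by (simp flip: m_assoc)
  define a b where "a = e \<otimes> w" and "b = r \<ominus> e \<otimes> r"
  define f where "f = b \<otimes> a"
  have c: "a \<in> carrier R" "b \<in> carrier R" "f \<in> carrier R" using w r ec by (simp_all add: a_def b_def f_def)
  have ea: "e \<otimes> a = a" unfolding a_def using ec w(1) ee by (simp flip: m_assoc)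
  have ae: "a \<otimes> e = \<zero>" unfolding a_def using ec w(1) we by (simp add: m_assoc)
  have "e \<otimes> b = e \<otimes> r \<ominus> (e \<otimes> e) \<otimes> r" unfolding b_def using ec r(1) by algebra
  then have eb: "e \<otimes> b = \<zero>" unfolding ee using ec r(1) by (simp add: minus_eq r_neg)
  have "b \<otimes> e = r \<otimes> e \<ominus> e \<otimes> (r \<otimes> e)" unfolding b_def using ec r(1) by algebra
  then have be: "b \<otimes> e = b" unfolding r(2) b_def .
  have "a \<otimes> b = e \<otimes> (w \<otimes> r) \<ominus> e \<otimes> (w \<otimes> e) \<otimes> r" unfolding a_def b_def using ec r(1) w(1) by algebra
  then have ab: "a \<otimes> b = e" unfolding wr we using ec r(1) ee by (simp add: minus_eq)
  have aa: "a \<otimes> a = \<zero>"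
  proof -
    have "a \<otimes> (e \<otimes> a) = (a \<otimes> e) \<otimes> a" using c ec by (simp add: m_assoc)
    then show ?thesis using ea ae c by simp
  qed
  have bb: "b \<otimes> b = \<zero>"
  proof -
    have "(b \<otimes> e) \<otimes> b = b \<otimes> (e \<otimes> b)" using c ec by (simp add: m_assoc)
    then show ?thesis using eb be c by simp
  qed
  have ef: "e \<otimes> f = \<zero>" unfolding f_def using c ec eb by (simp flip: m_assoc)
  have fe: "f \<otimes> e = \<zero>" unfolding f_def using c ec ae by (simp add: m_assoc)
  have af: "a \<otimes> f = a" unfolding f_def using c ab ea by (simp flip: m_assoc)
  have fa: "f \<otimes> a = \<zero>" unfolding f_def using c aa by (simp add: m_assoc)
  have fb: "f \<otimes> b = b" unfolding f_def using c ab be by (simp add: m_assoc)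
  have bf: "b \<otimes> f = \<zero>" unfolding f_def using c bb by (simp flip: m_assoc)
  have ff: "f \<otimes> f = f"
  proof -
    have "f \<otimes> (b \<otimes> a) = (f \<otimes> b) \<otimes> a" using c by (simp add: m_assoc)
    then show ?thesis using fb by (simp add: f_def)
  qed
  note table = ee ea ae eb be ab aa bb ef fe af fa fb bf ff f_def[symmetric]
  define y g where "y = a \<oplus> b \<ominus> f" and "g = e \<oplus> f"
  have "g = \<zero>"
  proof (rule fibonacci_corner_trivial[OF units])
    show "y \<in> carrier R" "g \<in> carrier R" using c ec by (simp_all add: y_def g_def)
    have "y \<otimes> y = \<ominus> a \<oplus> e \<oplus> (\<ominus> b \<oplus> f \<oplus> f)" unfolding y_def using c ec
      by (simp add: minus_eq l_distr r_distr l_minus r_minus minus_add table a_ac)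
    also have "\<dots> = g \<ominus> y" unfolding y_def g_def using c ec by algebra
    finally show "y \<otimes> y = g \<ominus> y" .
    show "g \<otimes> y = y" "y \<otimes> g = y" "g \<otimes> g = g" unfolding y_def g_def using c ec
      by (simp_all add: minus_eq l_distr r_distr l_minus r_minus minus_add table a_ac)
  qed
  then have "e \<otimes> (e \<oplus> f) = \<zero>" using ec unfolding g_def by simp
  then have "e = \<zero>" using ec c by (simp add: r_distr ee ef)
  with r0(3) show False by (simp add: e_def)
qed

text \<open>Both \<open>ex(1 - e)\<close> and \<open>(1 - e)xe\<close> have square zero.\<close>

lemma idempotent_central_if_reduced:
  assumes red: "reduced_ring R" and e: "idempotent_in R e" and x: "x \<in> carrier R"
  shows "e \<otimes> x = x \<otimes> e"
proof -
  have ec: "e \<in> carrier R" and ee: "e \<otimes> e = e" using e by (simp_all add: idempotent_in_def)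
  define p q where "p = e \<otimes> x \<ominus> e \<otimes> x \<otimes> e" and "q = x \<otimes> e \<ominus> e \<otimes> x \<otimes> e"
  have pq: "p \<in> carrier R" "q \<in> carrier R" using ec x by (simp_all add: p_def q_def)
  have "p \<otimes> e = e \<otimes> x \<otimes> e \<ominus> e \<otimes> x \<otimes> (e \<otimes> e)" unfolding p_def using ec x by algebra
  then have pe: "p \<otimes> e = \<zero>" unfolding ee using ec x by (simp add: minus_eq r_neg)
  have "e \<otimes> p = (e \<otimes> e) \<otimes> x \<ominus> (e \<otimes> e) \<otimes> x \<otimes> e" unfolding p_def using ec x by algebra
  then have ep: "e \<otimes> p = p" unfolding ee p_def .
  have "p \<otimes> (e \<otimes> p) = (p \<otimes> e) \<otimes> p" using pq ec by (simp add: m_assoc)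
  then have "p \<otimes> p = \<zero>" using pe ep pq by simp
  then have "p = \<zero>" using red pq unfolding reduced_ring_def by blast
  then have 1: "e \<otimes> x = e \<otimes> x \<otimes> e" using ec x unfolding p_def by simp
  have "e \<otimes> q = e \<otimes> x \<otimes> e \<ominus> (e \<otimes> e) \<otimes> x \<otimes> e" unfolding q_def using ec x by algebra
  then have eq: "e \<otimes> q = \<zero>" unfolding ee using ec x by (simp add: minus_eq r_neg)
  have "q \<otimes> e = x \<otimes> (e \<otimes> e) \<ominus> e \<otimes> x \<otimes> (e \<otimes> e)" unfolding q_def using ec x by algebra
  then have qe: "q \<otimes> e = q" unfolding ee q_def .
  have "(q \<otimes> e) \<otimes> q = q \<otimes> (e \<otimes> q)" using pq ec by (simp add: m_assoc)
  then have "q \<otimes> q = \<zero>" using qe eq pq by simp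
  then have "q = \<zero>" using red pq unfolding reduced_ring_def by blast
  then have "x \<otimes> e = e \<otimes> x \<otimes> e" using ec x unfolding q_def by simp
  with 1 show ?thesis by simp
qed

text \<open>
  If \<open>d = a\<^sup>3 - a\<close> is nonzero, choose a nonzero idempotent \<open>e = dr\<close>; it is central. Since
  \<open>e = a(a\<^sup>2 - 1)r\<close>, the element \<open>ea\<close> is right invertible in \<open>eR\<close>, so \<open>u = ea + (1 - e)\<close> is right
  invertible, and a unit because idempotents are central. Now \<open>u\<^sup>2 = 1\<close> gives \<open>ea\<^sup>2 = e\<close>, whence
  \<open>ed = 0\<close> and \<open>e = edr = 0\<close>.
\<close>

lemma tripotent_if_reduced_idempotent_rich:
  assumes red: "reduced_ring R" and rich: "idempotent_rich R"
    and units: "\<And>u. u \<in> Units R \<Longrightarrow> u \<otimes> u = \<one>" and a: "a \<in> carrier R"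
  shows "a \<otimes> (a \<otimes> a) = a"
proof (rule ccontr)
  assume neq: "a \<otimes> (a \<otimes> a) \<noteq> a"
  define d where "d = a \<otimes> (a \<otimes> a) \<ominus> a"
  have "d \<in> carrier R" "d \<noteq> \<zero>" using a neq by (simp_all add: d_def)
  then obtain r where r: "r \<in> carrier R" "idempotent_in R (d \<otimes> r)" "d \<otimes> r \<noteq> \<zero>"
    using rich unfolding idempotent_rich_def by blast
  define e where "e = d \<otimes> r"
  note central = idempotent_central_if_reduced[OF red]
  have ec: "e \<in> carrier R" and ee: "e \<otimes> e = e" using r(2) by (simp_all add: e_def idempotent_in_def)
  have ei: "idempotent_in R e" using r(2) by (simp add: e_def)
  define s where "s = (a \<otimes> a \<ominus> \<one>) \<otimes> r"
  have s: "s \<in> carrier R" using a r by (simp add: s_def)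
  have "a \<otimes> s = d \<otimes> r" unfolding s_def d_def using a r(1) by (simp add: ring_simprules)
  then have as: "a \<otimes> s = e" by (simp add: e_def)
  define h k where "h = e \<otimes> a" and "k = e \<otimes> s"
  have c: "h \<in> carrier R" "k \<in> carrier R" using ec a s by (simp_all add: h_def k_def)
  have eh: "e \<otimes> h = h" unfolding h_def using ec a ee by (simp flip: m_assoc)
  have ek: "e \<otimes> k = k" unfolding k_def using ec s ee by (simp flip: m_assoc)
  have he: "h \<otimes> e = h" and ke: "k \<otimes> e = k" using central[OF ei] c eh ek by simp_all
  have "h \<otimes> k = (e \<otimes> a) \<otimes> (e \<otimes> s)" by (simp add: h_def k_def)
  also have "\<dots> = (h \<otimes> e) \<otimes> s" using ec a s by (simp add: h_def m_assoc)
  also have "\<dots> = e \<otimes> (a \<otimes> s)" unfolding he using ec a s by (simp add: h_def m_assoc)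
  finally have hk: "h \<otimes> k = e" using as ee by simp
  define u v where "u = h \<oplus> (\<one> \<ominus> e)" and "v = k \<oplus> (\<one> \<ominus> e)"
  have uvc: "u \<in> carrier R" "v \<in> carrier R" using c ec by (simp_all add: u_def v_def)
  have prod: "(p \<oplus> (\<one> \<ominus> e)) \<otimes> (q \<oplus> (\<one> \<ominus> e)) = p \<otimes> q \<oplus> (\<one> \<ominus> e)"
    if "p \<in> carrier R" "q \<in> carrier R" "p \<otimes> e = p" "e \<otimes> q = q" for p q
  proof -
    have "(p \<oplus> (\<one> \<ominus> e)) \<otimes> (q \<oplus> (\<one> \<ominus> e))
        = p \<otimes> q \<oplus> (\<one> \<ominus> e) \<oplus> (p \<ominus> p \<otimes> e) \<oplus> (q \<ominus> e \<otimes> q) \<oplus> (e \<otimes> e \<ominus> e)"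
      using that(1,2) ec by (simp add: ring_simprules)
    then show ?thesis unfolding that(3,4) ee using that(1,2) ec by (simp add: minus_eq r_neg)
  qed
  have "u \<otimes> v = e \<oplus> (\<one> \<ominus> e)" unfolding u_def v_def using prod[of h k] c he ek hk by simp
  also have "\<dots> = \<one>" using ec by algebra
  finally have uv: "u \<otimes> v = \<one>" .
  have "v \<otimes> u \<otimes> (v \<otimes> u) = v \<otimes> (u \<otimes> v) \<otimes> u" using uvc by (simp add: m_assoc)
  then have vu: "idempotent_in R (v \<otimes> u)" using uv uvc by (simp add: idempotent_in_def)
  (* Direct finiteness: the idempotent v u is central, so it can be moved between u and v. *)
  have "v \<otimes> u = (v \<otimes> u) \<otimes> u \<otimes> v" using uv uvc by (simp add: m_assoc)
  also have "\<dots> = u \<otimes> (v \<otimes> u) \<otimes> v" using central[OF vu uvc(1)] by simp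
  also have "\<dots> = (u \<otimes> v) \<otimes> (u \<otimes> v)" using uvc by (simp add: m_assoc)
  finally have "v \<otimes> u = \<one>" using uv by simp
  with uv uvc have "u \<in> Units R" by (auto simp: Units_def)
  then have "u \<otimes> u = \<one>" by (rule units)
  moreover have "u \<otimes> u = h \<otimes> h \<oplus> (\<one> \<ominus> e)" unfolding u_def using prod[of h h] c he eh by simp
  moreover have "h \<otimes> h = h \<otimes> h \<oplus> (\<one> \<ominus> e) \<ominus> (\<one> \<ominus> e)" using c ec by algebra
  ultimately have "h \<otimes> h = \<one> \<ominus> (\<one> \<ominus> e)" by simp
  then have hh: "h \<otimes> h = e" using ec by (simp add: ring_simprules)
  have "h \<otimes> h = (h \<otimes> e) \<otimes> a" unfolding h_def using ec a by (simp add: m_assoc)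
  then have ha: "h \<otimes> a = e" using he hh by simp
  have "e \<otimes> d = (h \<otimes> a) \<otimes> a \<ominus> h" unfolding d_def h_def using ec a by algebra
  then have "e \<otimes> d = \<zero>" unfolding ha using c by (simp add: h_def minus_eq r_neg)
  moreover have "e \<otimes> (d \<otimes> r) = (e \<otimes> d) \<otimes> r" using ec r(1) \<open>d \<in> carrier R\<close> by (simp add: m_assoc)
  ultimately have "e = \<zero>" using ee r(1) by (simp flip: e_def)
  with r(3) show False by (simp add: e_def)
qed

end

section \<open>Passing to the quotient by the radical\<close>

text \<open>In \<open>x - x\<^sup>3 = x(1 - x\<^sup>2)\<close> the second factor is right invertible and commutes with \<open>x\<close>.\<close>

lemma (in ring) jacobson_radical_nil_if_nil_tripotent:
  assumes nt: "nil_tripotent R" and x: "x \<in> jacobson_radical R"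
  shows "nilpotent_in R x"
proof -
  have xc: "x \<in> carrier R" using x by (simp add: jacobson_radical_def)
  obtain c where c: "nilpotent_in R c" "x \<otimes> (x \<otimes> x) = x \<oplus> c"
    using nt xc unfolding nil_tripotent_def by blast
  have cc: "c \<in> carrier R" using c(1) by (simp add: nilpotent_in_def)
  define z where "z = \<one> \<ominus> x \<otimes> x"
  have z: "z \<in> carrier R" using xc by (simp add: z_def)
  have z_inv: "right_invertible_in R z"
    using x xc unfolding z_def jacobson_radical_iff by blast
  have "x \<otimes> z = x \<ominus> x \<otimes> (x \<otimes> x)" unfolding z_def using xc by (simp add: minus_eq r_distr r_minus)
  also have "\<dots> = \<ominus> c" unfolding c(2) using xc cc by algebra
  finally have "nilpotent_in R (x \<otimes> z)" using nilpotent_minus[OF c(1)] by simp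
  then obtain n :: nat where n: "(x \<otimes> z) [^] n = \<zero>" by (auto simp: nilpotent_in_def)
  have xz: "x \<otimes> z = z \<otimes> x" unfolding z_def using xc by (simp add: minus_eq r_distr l_distr r_minus l_minus m_assoc)
  have "right_invertible_in R (z [^] k)" for k :: nat
  proof (induction k)
    case 0
    then show ?case by (auto simp: right_invertible_in_def)
  next
    case (Suc k)
    then show ?case using right_invertible_mult z z_inv by simp
  qed
  then obtain s where s: "s \<in> carrier R" "z [^] n \<otimes> s = \<one>" by (auto simp: right_invertible_in_def)
  have "x [^] n = x [^] n \<otimes> (z [^] n \<otimes> s)" using s(2) xc by simp
  also have "\<dots> = (x \<otimes> z) [^] n \<otimes> s" using xc z s(1) by (simp add: pow_mult_distrib[OF xz] m_assoc)
  finally have "x [^] n = \<zero>" using n s(1) by simp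
  then show ?thesis using xc by (auto simp: nilpotent_in_def)
qed

context ring_hom_ring begin

lemma nil_tripotent_image:
  assumes surj: "h ` carrier R = carrier S" and nt: "nil_tripotent R"
  shows "nil_tripotent S"
  unfolding nil_tripotent_def
proof
  fix b assume "b \<in> carrier S"
  then obtain a where a: "a \<in> carrier R" "b = h a" using surj by blast
  then obtain c where c: "nilpotent_in R c" "a \<otimes> (a \<otimes> a) = a \<oplus> c"
    using nt unfolding nil_tripotent_def by blast
  obtain n :: nat where n: "c \<in> carrier R" "c [^] n = \<zero>" using c(1) by (auto simp: nilpotent_in_def)
  have "h c [^]\<^bsub>S\<^esub> n = \<zero>\<^bsub>S\<^esub>" using n hom_nat_pow[of c n] by simp
  then have "nilpotent_in S (h c)" using n(1) by (auto simp: nilpotent_in_def)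
  moreover have "b \<otimes>\<^bsub>S\<^esub> (b \<otimes>\<^bsub>S\<^esub> b) = b \<oplus>\<^bsub>S\<^esub> h c"
    using arg_cong[OF c(2), of h] a n(1) by simp
  ultimately show "\<exists>c. nilpotent_in S c \<and> b \<otimes>\<^bsub>S\<^esub> (b \<otimes>\<^bsub>S\<^esub> b) = b \<oplus>\<^bsub>S\<^esub> c" by blast
qed

lemma hom_minus: "x \<in> carrier R \<Longrightarrow> y \<in> carrier R \<Longrightarrow> h (x \<ominus> y) = h x \<ominus>\<^bsub>S\<^esub> h y"
  by (simp add: R.minus_eq S.minus_eq)

lemma weakly_exchange_image:
  assumes surj: "h ` carrier R = carrier S" and we: "weakly_exchange R"
  shows "weakly_exchange S"
  unfolding weakly_exchange_def
proof
  fix b assume "b \<in> carrier S"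
  then obtain a where a: "a \<in> carrier R" "b = h a" using surj by blast
  then obtain e where e: "idempotent_in R e" "e \<in> a <# carrier R"
      "\<one> \<ominus> e \<in> ((\<one> \<ominus> a) <# carrier R) \<union> ((\<one> \<oplus> a) <# carrier R)"
    using we unfolding weakly_exchange_def by blast
  have ec: "e \<in> carrier R" using e(1) by (simp add: idempotent_in_def)
  have coset: "h y \<in> h x <#\<^bsub>S\<^esub> carrier S" if "y \<in> x <# carrier R" "x \<in> carrier R" for x y
    using that by (auto simp: l_coset_def)
  have "idempotent_in S (h e)" using e(1) hom_mult[of e e] by (simp add: idempotent_in_def)
  moreover have "h e \<in> b <#\<^bsub>S\<^esub> carrier S" using coset[OF e(2)] a by simp
  moreover have "\<one>\<^bsub>S\<^esub> \<ominus>\<^bsub>S\<^esub> h e \<in>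
      ((\<one>\<^bsub>S\<^esub> \<ominus>\<^bsub>S\<^esub> b) <#\<^bsub>S\<^esub> carrier S) \<union> ((\<one>\<^bsub>S\<^esub> \<oplus>\<^bsub>S\<^esub> b) <#\<^bsub>S\<^esub> carrier S)"
    using e(3) coset[of "\<one> \<ominus> e" "\<one> \<ominus> a"] coset[of "\<one> \<ominus> e" "\<one> \<oplus> a"] a ec
    by (auto simp: hom_minus)
  ultimately show "\<exists>e. idempotent_in S e \<and> e \<in> b <#\<^bsub>S\<^esub> carrier S \<and> \<one>\<^bsub>S\<^esub> \<ominus>\<^bsub>S\<^esub> e \<in>
      ((\<one>\<^bsub>S\<^esub> \<ominus>\<^bsub>S\<^esub> b) <#\<^bsub>S\<^esub> carrier S) \<union> ((\<one>\<^bsub>S\<^esub> \<oplus>\<^bsub>S\<^esub> b) <#\<^bsub>S\<^esub> carrier S)"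
    by blast
qed

text \<open>
  An element that is right invertible modulo the radical is right invertible: if \<open>p\<close> is congruent
  to 1, then \<open>p = 1 - (1 - p)\<close> is right invertible by the description of the radical.
\<close>

lemma jacobson_radical_image:
  assumes surj: "h ` carrier R = carrier S"
    and ker: "\<And>x. x \<in> carrier R \<Longrightarrow> h x = \<zero>\<^bsub>S\<^esub> \<longleftrightarrow> x \<in> jacobson_radical R"
  shows "jacobson_radical S = {\<zero>\<^bsub>S\<^esub>}"
proof
  show "{\<zero>\<^bsub>S\<^esub>} \<subseteq> jacobson_radical S"
    using ideal.axioms(1)[OF S.ideal_jacobson_radical] additive_subgroup.zero_closed by blast
  show "jacobson_radical S \<subseteq> {\<zero>\<^bsub>S\<^esub>}"
  proof
    fix y' assume y': "y' \<in> jacobson_radical S"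
    then obtain y where y: "y \<in> carrier R" "y' = h y" using surj by (auto simp: jacobson_radical_def)
    have "right_invertible_in R (\<one> \<ominus> y \<otimes> r)" if r: "r \<in> carrier R" for r
    proof -
      have "right_invertible_in S (h (\<one> \<ominus> y \<otimes> r))"
        using y' y r by (simp add: S.jacobson_radical_iff hom_minus)
      then obtain s' where s': "s' \<in> h ` carrier R" "h (\<one> \<ominus> y \<otimes> r) \<otimes>\<^bsub>S\<^esub> s' = \<one>\<^bsub>S\<^esub>"
        unfolding right_invertible_in_def surj by (elim bexE)
      from s'(1) obtain s where "s \<in> carrier R" "s' = h s" by (elim imageE)
      with s'(2) have s: "s \<in> carrier R" "h (\<one> \<ominus> y \<otimes> r) \<otimes>\<^bsub>S\<^esub> h s = \<one>\<^bsub>S\<^esub>" by simp_all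
      define p where "p = (\<one> \<ominus> y \<otimes> r) \<otimes> s"
      have p: "p \<in> carrier R" "h p = \<one>\<^bsub>S\<^esub>" using y r s by (simp_all add: p_def)
      then have "\<one> \<ominus> p \<in> jacobson_radical R" using ker[of "\<one> \<ominus> p"] by (simp add: hom_minus S.minus_eq S.r_neg)
      then have "right_invertible_in R (\<one> \<ominus> (\<one> \<ominus> p) \<otimes> \<one>)" unfolding R.jacobson_radical_iff by blast
      moreover have "\<one> \<ominus> (\<one> \<ominus> p) \<otimes> \<one> = p" using p(1) by (simp, algebra)
      ultimately obtain t where t: "t \<in> carrier R" "p \<otimes> t = \<one>" by (auto simp: right_invertible_in_def)
      have "(\<one> \<ominus> y \<otimes> r) \<otimes> (s \<otimes> t) = \<one>"
        using t y r s(1) by (simp add: p_def R.m_assoc)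
      then show ?thesis using s(1) t(1) by (auto simp: right_invertible_in_def)
    qed
    then have "y \<in> jacobson_radical R" using y(1) by (simp add: R.jacobson_radical_iff)
    then show "y' \<in> {\<zero>\<^bsub>S\<^esub>}" using ker y by simp
  qed
qed

end

text \<open>The nilpotent element \<open>u\<^sup>3 - u\<close> is \<open>u\<^sup>2 - 1\<close> times the commuting unit \<open>u\<close>.\<close>

lemma (in ring) unit_square_minus_one_nilpotent:
  assumes nt: "nil_tripotent R" and u: "u \<in> Units R"
  shows "nilpotent_in R (u \<otimes> u \<ominus> \<one>)"
proof -
  have uc: "u \<in> carrier R" using u by (rule Units_closed)
  obtain c where c: "nilpotent_in R c" "u \<otimes> (u \<otimes> u) = u \<oplus> c"
    using nt uc unfolding nil_tripotent_def by blast
  have cc: "c \<in> carrier R" using c(1) by (simp add: nilpotent_in_def)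
  define z v where "z = u \<otimes> u \<ominus> \<one>" and "v = inv u"
  have z: "z \<in> carrier R" using uc by (simp add: z_def)
  have v: "v \<in> carrier R" "v \<otimes> u = \<one>" "u \<otimes> v = \<one>" using u by (simp_all add: v_def)
  have "z \<otimes> u = u \<otimes> (u \<otimes> u) \<ominus> u" unfolding z_def using uc by (simp add: minus_eq l_distr l_minus m_assoc)
  also have "\<dots> = c" unfolding c(2) using uc cc by algebra
  finally have zu: "z \<otimes> u = c" .
  have uz: "z \<otimes> u = u \<otimes> z" unfolding z_def using uc by (simp add: minus_eq l_distr r_distr l_minus r_minus m_assoc)
  obtain n :: nat where "c [^] n = \<zero>" using c(1) by (auto simp: nilpotent_in_def)
  then have 1: "z [^] n \<otimes> u [^] n = \<zero>" using pow_mult_distrib[OF uz z uc, of n] zu by simp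
  have 2: "u [^] n \<otimes> v [^] n = \<one>" using pow_mult_distrib[of u v n] uc v by simp
  have "z [^] n = z [^] n \<otimes> (u [^] n \<otimes> v [^] n)" using 2 z by simp
  also have "\<dots> = (z [^] n \<otimes> u [^] n) \<otimes> v [^] n" using z uc v by (simp add: m_assoc)
  finally have "z [^] n = \<zero>" using 1 v by simp
  then show ?thesis using z unfolding nilpotent_in_def z_def by blast
qed

theorem theorem3p3:
  fixes R :: "('a, 'm) ring_scheme"
  assumes "ring R"
  shows "strongly_2_nil_clean R \<longleftrightarrow>
    weakly_exchange R \<and>
    (\<forall>x\<in>jacobson_radical R. nilpotent_in R x) \<and>
    (\<forall>v\<in>Units (R Quot jacobson_radical R).
       v [^]\<^bsub>R Quot jacobson_radical R\<^esub> (2::nat) = \<one>\<^bsub>R Quot jacobson_radical R\<^esub>)"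
proof -
  interpret ring R by fact
  interpret J: ideal "jacobson_radical R" R by (rule ideal_jacobson_radical)
  define S where "S = R Quot jacobson_radical R"
  define h where "h = (\<lambda>x. jacobson_radical R +>\<^bsub>R\<^esub> x)"
  interpret h: ring_hom_ring R S h
    using J.rcos_ring_hom_ring unfolding S_def h_def .
  have surj: "h ` carrier R = carrier S"
    by (auto simp: S_def h_def FactRing_def A_RCOSETS_def')
  have ker: "h x = \<zero>\<^bsub>S\<^esub> \<longleftrightarrow> x \<in> jacobson_radical R" if "x \<in> carrier R" for x
    using that J.a_rcos_const J.rcos_const_imp_mem by (auto simp: S_def h_def FactRing_def)
  have JS: "jacobson_radical S = {\<zero>\<^bsub>S\<^esub>}"
    using h.jacobson_radical_image[OF surj ker] by simp
  show ?thesis unfolding S_def[symmetric]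
  proof (intro iffI conjI ballI)
    assume "strongly_2_nil_clean R"
    then have nt: "nil_tripotent R" by (rule nil_tripotent_if_strongly_2_nil_clean)
    then show "weakly_exchange R" by (rule weakly_exchange_if_nil_tripotent)
    show "nilpotent_in R x" if "x \<in> jacobson_radical R" for x
      using jacobson_radical_nil_if_nil_tripotent nt that by blast
    have ntS: "nil_tripotent S" by (rule h.nil_tripotent_image[OF surj nt])
    note nilS = h.S.unit_square_minus_one_nilpotent[OF ntS]
    have "reduced_ring S"
      by (intro h.S.reduced_if_idempotent_rich h.S.idempotent_rich_if_nil_tripotent JS ntS nilS)
    fix v assume v: "v \<in> Units S"
    have "v \<otimes>\<^bsub>S\<^esub> v \<ominus>\<^bsub>S\<^esub> \<one>\<^bsub>S\<^esub> = \<zero>\<^bsub>S\<^esub>"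
      using h.S.nilpotent_zero_if_reduced[OF \<open>reduced_ring S\<close>] nilS[OF v] by blast
    then show "v [^]\<^bsub>S\<^esub> (2::nat) = \<one>\<^bsub>S\<^esub>"
      using h.S.Units_closed[OF v] by (simp add: numeral_2_eq_2)
  next
    assume "weakly_exchange R \<and> (\<forall>x\<in>jacobson_radical R. nilpotent_in R x) \<and>
      (\<forall>v\<in>Units S. v [^]\<^bsub>S\<^esub> (2::nat) = \<one>\<^bsub>S\<^esub>)"
    then have we: "weakly_exchange R" and Jnil: "\<And>x. x \<in> jacobson_radical R \<Longrightarrow> nilpotent_in R x"
      and exp: "\<And>v. v \<in> Units S \<Longrightarrow> v [^]\<^bsub>S\<^esub> (2::nat) = \<one>\<^bsub>S\<^esub>" by auto
    have units: "v \<otimes>\<^bsub>S\<^esub> v = \<one>\<^bsub>S\<^esub>" if "v \<in> Units S" for v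
      using exp[OF that] h.S.Units_closed[OF that] by (simp add: numeral_2_eq_2)
    have rich: "idempotent_rich S"
      by (intro h.S.idempotent_rich_if_weakly_exchange JS units h.weakly_exchange_image[OF surj we])
    have red: "reduced_ring S"
    proof (rule h.S.reduced_if_idempotent_rich[OF rich])
      fix u assume "u \<in> Units S"
      then show "nilpotent_in S (u \<otimes>\<^bsub>S\<^esub> u \<ominus>\<^bsub>S\<^esub> \<one>\<^bsub>S\<^esub>)"
        by (auto simp: units nilpotent_in_def h.S.minus_eq h.S.r_neg
          intro: exI[of _ "1::nat"])
    qed
    have "nil_tripotent R" unfolding nil_tripotent_def
    proof
      fix a assume a: "a \<in> carrier R"
      define c where "c = a \<otimes>\<^bsub>R\<^esub> (a \<otimes>\<^bsub>R\<^esub> a) \<ominus>\<^bsub>R\<^esub> a"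
      have c: "c \<in> carrier R" using a by (simp add: c_def)
      have "h a \<otimes>\<^bsub>S\<^esub> (h a \<otimes>\<^bsub>S\<^esub> h a) = h a"
        by (rule h.S.tripotent_if_reduced_idempotent_rich[OF red rich units]) (use a in auto)
      then have "h c = \<zero>\<^bsub>S\<^esub>" using a unfolding c_def by (simp add: h.hom_minus h.S.minus_eq h.S.r_neg)
      then have "nilpotent_in R c" using Jnil ker[OF c] by blast
      moreover have "a \<otimes>\<^bsub>R\<^esub> (a \<otimes>\<^bsub>R\<^esub> a) = a \<oplus>\<^bsub>R\<^esub> c" unfolding c_def using a by algebra
      ultimately show "\<exists>c. nilpotent_in R c \<and> a \<otimes>\<^bsub>R\<^esub> (a \<otimes>\<^bsub>R\<^esub> a) = a \<oplus>\<^bsub>R\<^esub> c" by blast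
    qed
    then show "strongly_2_nil_clean R" by (rule strongly_2_nil_clean_if_nil_tripotent)
  qed
qed

end
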